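(* Let $\Gamma\subset\tilde\Gamma\subset \mathrm{SL}(2,\mathbb C)$ be discrete subgroups, both containing $\pm I_2$, such that $\Gamma\backslash\mathbb H^3$ has finite hyperbolic volume and $[\tilde\Gamma:\Gamma]<\infty$. Let $\chi$ be a finite dimensional unitary representation of $\Gamma$ and let $\pi=\mathrm{Ind}_{\Gamma}^{\tilde\Gamma}\chi$. Then the Selberg zeta functions satisfy $$Z(s;\Gamma;\chi)=Z(s;\tilde\Gamma;\pi),\qquad \mathrm{Re}(s)>1,$$ and this identity extends to every connected open set $U\supset\{\mathrm{Re}(s)>1\}$ of $\mathbb C$ to which both Selberg zeta functions admit meromorphic continuation.
   Context: $\mathbb H^3=\mathbb R^2\times(0,\infty)$ is hyperbolic 3-space (upper half-space model) with the standard isometric action of $\mathrm{SL}(2,\mathbb C)$. Let $G\subset\mathrm{SL}(2,\mathbb C)$ be a discrete subgroup containing $\pm I_2$ such that $G\backslash\mathbb H^3$ has finite hyperbolic volume, and let $\rho$ be a finite dimensional unitary representation of $G$. An element $P\in G$ is called hyperbolic if $\mathrm{tr}(P)\notin[-2,2]$ (this includes loxodromic elements). For hyperbolic $P\in G$: - $a(P)$ is the eigenvalue of $P$ with $|a(P)|>1$, and $N(P)=NP=|a(P)|^2$ is the norm of $P$. - The centralizer $C_G(P)$ of $P$ in $G$ is a finitely generated abelian group of rank one; write $C_G(P)=C_G(P)^{\mathrm{free}}\times C_G(P)^{\mathrm{tor}}$ for its decomposition into free and torsion parts. $P_0$ denotes a generator of $C_G(P)^{\mathrm{free}}$ (its norm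 $NP_0$ does not depend on the choices), and $m(P)=|C_G(P)^{\mathrm{tor}}|$. The Selberg zeta function $Z(s;G;\rho)$ is the unique holomorphic function on $\mathrm{Re}(s)>1$ whose logarithmic derivative is $$\frac{d}{ds}\log Z(s;G;\rho)=\sum_{[P]_G}\frac{\mathrm{tr}\,\rho(P)\,\log(NP_0)}{m(P)\,|a(P)-a(P)^{-1}|^2}\,(NP)^{-s},\qquad \mathrm{Re}(s)>1,$$ (sum over the $G$-conjugacy classes $[P]_G$ of hyperbolic elements of $G$, absolutely convergent) and which satisfies $\lim_{\mathrm{Re}(s)\to+\infty}Z(s;G;\rho)=1$. *)

theory Defs
  imports
    "HOL-Complex_Analysis.Complex_Analysis"
    "HOL-Algebra.Coset"
    "HOL-Algebra.Generated_Groups"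
begin

section \<open>Discrete subgroups of finite covolume\<close>

definition SL2C :: "(complex^2^2) monoid" where
  "SL2C = \<lparr>carrier = {A. det A = 1}, mult = (**), one = mat 1\<rparr>"

definition discrete_subgroup_pm :: "(complex^2^2) set \<Rightarrow> bool" where
  "discrete_subgroup_pm G \<longleftrightarrow> subgroup G SL2C \<and> discrete G \<and> - mat 1 \<in> G"

definition finite_index :: "(complex^2^2) set \<Rightarrow> (complex^2^2) set \<Rightarrow> bool" where
  "finite_index K G \<longleftrightarrow> finite (rcosets\<^bsub>SL2C\<lparr>carrier := G\<rparr>\<^esub> K)"

text \<open>
  The upper half-space consists of the points \<open>(z, r)\<close> with \<open>z\<close> complex and \<open>r > 0\<close>.
  The action is the Poincare extension: writing the point as the quaternion \<open>w = z + r j\<close>, the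
  matrix with rows \<open>(a, b)\<close> and \<open>(c, d)\<close> maps \<open>w\<close> to the product of \<open>a w + b\<close>
  with the inverse of \<open>c w + d\<close>.
\<close>

definition H3 :: "(complex \<times> real) set" where
  "H3 = {p. snd p > 0}"

definition H3_act :: "complex^2^2 \<Rightarrow> complex \<times> real \<Rightarrow> complex \<times> real" where
  "H3_act A = (\<lambda>(z, r).
     let a = A$1$1; b = A$1$2; c = A$2$1; d = A$2$2;
         q = (cmod (c * z + d))\<^sup>2 + (cmod c)\<^sup>2 * r\<^sup>2
     in (((a * z + b) * cnj (c * z + d) + a * cnj c * of_real (r\<^sup>2)) / of_real q, r / q))"

definition hyperbolic_volume :: "(complex \<times> real) measure" where
  "hyperbolic_volume = density lborel (\<lambda>p. indicator H3 p * ennreal (1 / snd p ^ 3))"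

definition fundamental_domain :: "(complex^2^2) set \<Rightarrow> (complex \<times> real) set \<Rightarrow> bool" where
  "fundamental_domain G F \<longleftrightarrow>
     F \<in> sets borel \<and> F \<subseteq> H3 \<and> (\<Union>g\<in>G. H3_act g ` F) = H3 \<and>
     (\<forall>g \<in> G - {mat 1, - mat 1}. F \<inter> H3_act g ` F \<in> null_sets hyperbolic_volume)"

text \<open>
  The volume of the quotient is the volume of any measurable fundamental domain. The elements
  \<open>mat 1\<close> and \<open>- mat 1\<close> are exactly those acting trivially.
\<close>

definition finite_covolume :: "(complex^2^2) set \<Rightarrow> bool" where
  "finite_covolume G \<longleftrightarrow>
     (\<exists>F. fundamental_domain G F \<and> emeasure hyperbolic_volume F < \<infinity>)"


section \<open>Unitary and induced representations\<close>

definition unitary_matrix :: "complex^'n^'n \<Rightarrow> bool" where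
  "unitary_matrix A \<longleftrightarrow> A ** (\<chi> i j. cnj (A$j$i)) = mat 1"

definition unitary_rep :: "(complex^2^2) set \<Rightarrow> (complex^2^2 \<Rightarrow> complex^'n^'n) \<Rightarrow> bool" where
  "unitary_rep G \<rho> \<longleftrightarrow>
     (\<forall>g\<in>G. unitary_matrix (\<rho> g)) \<and> (\<forall>g\<in>G. \<forall>h\<in>G. \<rho> (g ** h) = \<rho> g ** \<rho> h)"

text \<open>
  The space of the representation of \<open>G\<close> induced from the representation \<open>\<rho>\<close> of \<open>K\<close>:
  functions on \<open>G\<close>, here extended by 0, which are \<open>K\<close>-equivariant from the left.
  The group \<open>G\<close> acts by right translation.
\<close>

definition induced_space ::
  "(complex^2^2) set \<Rightarrow> (complex^2^2) set \<Rightarrow> (complex^2^2 \<Rightarrow> complex^'n^'n) \<Rightarrow>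
   (complex^2^2 \<Rightarrow> complex^'n) set" where
  "induced_space K G \<rho> =
     {f. (\<forall>x. x \<notin> G \<longrightarrow> f x = 0) \<and> (\<forall>k\<in>K. \<forall>x\<in>G. f (k ** x) = \<rho> k *v f x)}"

text \<open>
  \<open>\<sigma>\<close> is the induced representation, written as matrices with respect to some basis of the
  induced space. In particular the cardinality of the index type \<open>'m\<close> is the index of \<open>K\<close>
  in \<open>G\<close> times that of \<open>'n\<close>.
\<close>

definition is_induced_rep ::
  "(complex^2^2) set \<Rightarrow> (complex^2^2) set \<Rightarrow> (complex^2^2 \<Rightarrow> complex^'n^'n) \<Rightarrow>
   (complex^2^2 \<Rightarrow> complex^'m^'m) \<Rightarrow> bool" where
  "is_induced_rep K G \<rho> \<sigma> \<longleftrightarrow>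
     (\<exists>T :: complex^'m \<Rightarrow> complex^2^2 \<Rightarrow> complex^'n.
        bij_betw T UNIV (induced_space K G \<rho>) \<and>
        (\<forall>u v. T (u + v) = (\<lambda>x. T u x + T v x)) \<and>
        (\<forall>c v. T (c *s v) = (\<lambda>x. c *s T v x)) \<and>
        (\<forall>g\<in>G. \<forall>v. T (\<sigma> g *v v) = (\<lambda>x. T v (x ** g))))"


section \<open>Hyperbolic elements\<close>

definition hyperbolic :: "complex^2^2 \<Rightarrow> bool" where
  "hyperbolic P \<longleftrightarrow> trace P \<notin> complex_of_real ` {-2..2}"

definition hyperbolic_eigenvalue :: "complex^2^2 \<Rightarrow> complex" where
  "hyperbolic_eigenvalue P = (THE a. cmod a > 1 \<and> (\<exists>v. v \<noteq> 0 \<and> P *v v = a *s v))"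

definition hyperbolic_norm :: "complex^2^2 \<Rightarrow> real" where
  "hyperbolic_norm P = (cmod (hyperbolic_eigenvalue P))\<^sup>2"

definition centralizer :: "(complex^2^2) set \<Rightarrow> complex^2^2 \<Rightarrow> (complex^2^2) set" where
  "centralizer G P = {g \<in> G. g ** P = P ** g}"

definition centralizer_tor :: "(complex^2^2) set \<Rightarrow> complex^2^2 \<Rightarrow> (complex^2^2) set" where
  "centralizer_tor G P =
     {g \<in> centralizer G P. \<exists>n::nat. n > 0 \<and> g [^]\<^bsub>SL2C\<^esub> n = \<one>\<^bsub>SL2C\<^esub>}"

text \<open>
  \<open>P\<^sub>0\<close> generates an infinite cyclic group which is a complement of the torsion part of the
  centralizer of \<open>P\<close>. Neither the complement nor its generator is unique; the norm of
  \<open>P\<^sub>0\<close> does not depend on the choice.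
\<close>

definition generates_centralizer_free ::
  "(complex^2^2) set \<Rightarrow> complex^2^2 \<Rightarrow> complex^2^2 \<Rightarrow> bool" where
  "generates_centralizer_free G P P\<^sub>0 \<longleftrightarrow>
     P\<^sub>0 \<in> centralizer G P \<and> infinite (generate SL2C {P\<^sub>0}) \<and>
     generate SL2C {P\<^sub>0} \<inter> centralizer_tor G P = {\<one>\<^bsub>SL2C\<^esub>} \<and>
     generate SL2C {P\<^sub>0} <#>\<^bsub>SL2C\<^esub> centralizer_tor G P = centralizer G P"

definition primitive_element :: "(complex^2^2) set \<Rightarrow> complex^2^2 \<Rightarrow> complex^2^2" where
  "primitive_element G P = (SOME P\<^sub>0. generates_centralizer_free G P P\<^sub>0)"

definition conj_class :: "(complex^2^2) set \<Rightarrow> complex^2^2 \<Rightarrow> (complex^2^2) set" where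
  "conj_class G P = (\<lambda>g. g ** P ** matrix_inv g) ` G"

definition hyperbolic_classes :: "(complex^2^2) set \<Rightarrow> (complex^2^2) set set" where
  "hyperbolic_classes G = conj_class G ` {P \<in> G. hyperbolic P}"


section \<open>The Selberg zeta function\<close>

definition selberg_term ::
  "(complex^2^2) set \<Rightarrow> (complex^2^2 \<Rightarrow> complex^'n^'n) \<Rightarrow> complex \<Rightarrow> complex^2^2 \<Rightarrow> complex" where
  "selberg_term G \<rho> s P =
     trace (\<rho> P) * of_real (ln (hyperbolic_norm (primitive_element G P))) /
       of_real (real (card (centralizer_tor G P)) *
         (cmod (hyperbolic_eigenvalue P - inverse (hyperbolic_eigenvalue P)))\<^sup>2) *
     of_real (hyperbolic_norm P) powr (- s)"

text \<open>
  The summand depends only on the conjugacy class, which is represented by an arbitrary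
  element. For complex series, \<open>has_sum\<close> means absolute convergence.
  The filter in the last clause expresses that the real part tends to infinity, uniformly in
  the imaginary part. Only the values of \<open>Z\<close> on the half-plane are constrained, and these
  are determined, see \<open>is_selberg_zeta_unique\<close>.
\<close>

definition is_selberg_zeta ::
  "(complex^2^2) set \<Rightarrow> (complex^2^2 \<Rightarrow> complex^'n^'n) \<Rightarrow> (complex \<Rightarrow> complex) \<Rightarrow> bool" where
  "is_selberg_zeta G \<rho> Z \<longleftrightarrow>
     Z holomorphic_on {s. Re s > 1} \<and>
     (\<forall>s. Re s > 1 \<longrightarrow> Z s \<noteq> 0 \<and>
        ((\<lambda>C. selberg_term G \<rho> s (SOME P. P \<in> C)) has_sum (deriv Z s / Z s))
          (hyperbolic_classes G)) \<and>
     (Z \<longlongrightarrow> 1) (filtercomap Re at_top)"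

lemma is_selberg_zeta_unique:
  assumes Z: "is_selberg_zeta G \<rho> Z" and W: "is_selberg_zeta G \<rho> W" and s: "Re s > 1"
  shows "Z s = W s"
proof -
  let ?H = "{s. Re s > 1}"
  have op: "open ?H" by (rule open_halfspace_Re_gt)
  have cv: "convex ?H" by (rule convex_halfspace_Re_gt)
  have "\<exists>c. \<forall>x\<in>?H. Z x / W x = c"
  proof (rule has_field_derivative_zero_constant[OF cv])
    fix x assume x: "x \<in> ?H"
    have dZ: "(Z has_field_derivative deriv Z x) (at x)"
      using Z x op unfolding is_selberg_zeta_def by (auto intro: holomorphic_derivI)
    have dW: "(W has_field_derivative deriv W x) (at x)"
      using W x op unfolding is_selberg_zeta_def by (auto intro: holomorphic_derivI)
    have nz: "Z x \<noteq> 0" "W x \<noteq> 0"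
      using Z W x unfolding is_selberg_zeta_def by auto
    have "deriv Z x / Z x = deriv W x / W x"
      using Z W x unfolding is_selberg_zeta_def by (auto intro: has_sum_unique)
    then have "(deriv Z x * W x - Z x * deriv W x) / (W x * W x) = 0"
      using nz by (simp add: field_simps)
    then show "((\<lambda>x. Z x / W x) has_field_derivative 0) (at x within ?H)"
      using DERIV_divide[OF dZ dW nz(2)] has_field_derivative_at_within by fastforce
  qed
  then obtain c where c: "\<And>x. Re x > 1 \<Longrightarrow> Z x / W x = c" by auto
  let ?F = "filtercomap Re at_top"
  have "((\<lambda>x. Z x / W x) \<longlongrightarrow> 1 / 1) ?F"
    using Z W unfolding is_selberg_zeta_def by (intro tendsto_divide) auto
  moreover have "eventually (\<lambda>x. Z x / W x = c) ?F"
    unfolding eventually_filtercomap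
    by (intro exI[of _ "\<lambda>r. r > 1"] conjI eventually_gt_at_top) (use c in auto)
  ultimately have "((\<lambda>x. c) \<longlongrightarrow> 1) ?F"
    by (simp add: tendsto_cong)
  moreover have "?F \<noteq> bot"
    by (intro filtercomap_neq_bot_surj surjI[of Re complex_of_real]) auto
  ultimately have "c = 1" by (metis tendsto_const tendsto_unique)
  then show ?thesis using c[OF s] W s unfolding is_selberg_zeta_def by auto
qed

end

theory Submission
  imports Defs "HOL-Algebra.Multiplicative_Group"
begin

text \<open>
  Both zeta functions are determined by their logarithmic derivatives, so it is enough that the
  two series agree. This is the invariance of the Selberg trace formula under induction, and it
  holds term by term: the summand of a conjugacy class \<open>C\<close> of the larger group \<open>G\<close>, with
  coefficients in the induced representation, is the finite sum of the summands of the conjugacy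
  classes of the subgroup \<open>K\<close> into which \<open>C \<inter> K\<close> decomposes (\<open>selberg_term_induced\<close>).
  Summing over \<open>C\<close> regroups the absolutely convergent series of \<open>K\<close>, so the zeta function
  of \<open>K\<close> has the defining properties of that of \<open>G\<close> (\<open>is_selberg_zeta_induced\<close>), and
  uniqueness finishes the proof on the half-plane. The identity theorem for meromorphic functions
  extends the equality to a connected domain.

  For one class, fix \<open>P \<in> C\<close>. By Frobenius (\<open>trace_induced\<close>), the trace of the
  induced representation at \<open>P\<close> is the sum of the traces of \<open>\<chi>\<close> at
  \<open>r P r\<^sup>-\<^sup>1\<close>, over the representatives \<open>r\<close> of the cosets \<open>K r\<close> for which this conjugate lies
  in \<open>K\<close>. The conjugates lying in the class of a given \<open>Q \<in> K\<close> contribute equally, and their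
  number is the index of the centralizer of \<open>Q\<close> in \<open>K\<close> in the centralizer of \<open>Q\<close> in
  \<open>G\<close>. What remains is the statement that this index is the factor by which
  \<open>log N(P\<^sub>0) / m(P)\<close> changes between the two groups (\<open>count_conjugates\<close>).

  That factor comes from counting lattice points. The logarithm of the modulus of the eigenvalue
  on a fixed eigenvector of \<open>P\<close> is a homomorphism from the centralizer to the reals. Discreteness
  makes its kernel finite and its image infinite cyclic; the kernel is the torsion part, with
  \<open>m(P)\<close> elements, and the image is generated by \<open>log N(P\<^sub>0)\<close>. Hence every half-open
  window of length \<open>log N(P\<^sub>0)\<close> contains the values of exactly \<open>m(P)\<close> elements
  (\<open>card_window\<close>). Counting the elements of the larger centralizer in a window of the length
  belonging to the smaller one, once directly and once coset by coset, gives the index.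
\<close>

(* The imported power series notation would make vector components ambiguous. *)
no_notation fps_nth (infixl \<open>$\<close> 75)

section \<open>The group of complex 2x2 matrices of determinant 1\<close>

definition adj2 :: "complex^2^2 \<Rightarrow> complex^2^2" where
  "adj2 A = vector [vector [A$2$2, - A$1$2], vector [- A$2$1, A$1$1]]"

lemma mult_adj2: "A ** adj2 A = mat (det A)"
  by (simp add: vec_eq_iff forall_2 adj2_def matrix_matrix_mult_def sum_2 mat_def det_2 algebra_simps)

lemma matrix_inv_unique:
  fixes A B :: "complex^'n^'n"
  assumes "A ** B = mat 1"
  shows "matrix_inv A = B"
proof -
  have BA: "B ** A = mat 1"
    using assms matrix_left_right_inverse by blast
  then have "A ** matrix_inv A = mat 1"
    using assms unfolding matrix_inv_def by (metis (mono_tags, lifting) someI_ex)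
  then have "B ** (A ** matrix_inv A) = B" by simp
  then show ?thesis by (simp add: matrix_mul_assoc BA)
qed

lemma matrix_inv_det1:
  assumes "det A = 1" shows "matrix_inv A = adj2 A"
  by (rule matrix_inv_unique) (simp add: mult_adj2 assms)

lemma carrier_SL2C [simp]: "A \<in> carrier SL2C \<longleftrightarrow> det A = 1"
  and mult_SL2C [simp]: "mult SL2C = (**)"
  and one_SL2C [simp]: "one SL2C = mat 1"
  by (auto simp: SL2C_def)

lemma SL2C_inverse:
  fixes A :: "complex^2^2"
  assumes "det A = 1"
  shows "A ** matrix_inv A = mat 1" "matrix_inv A ** A = mat 1" "det (matrix_inv A) = 1"
proof -
  show 1: "A ** matrix_inv A = mat 1"
    using mult_adj2[of A] by (simp add: matrix_inv_det1 assms)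
  then show "matrix_inv A ** A = mat 1"
    using matrix_left_right_inverse by blast
  show "det (matrix_inv A) = 1"
    using arg_cong[OF 1, of det] by (simp add: det_mul assms)
qed

lemma SL2C_cancel:
  fixes A :: "complex^2^2"
  assumes "det A = 1"
  shows "X ** A ** matrix_inv A = X" "X ** matrix_inv A ** A = X"
  by (simp_all add: SL2C_inverse[OF assms] flip: matrix_mul_assoc)

lemma group_SL2C: "group SL2C"
proof (rule groupI)
  show "\<exists>y\<in>carrier SL2C. y \<otimes>\<^bsub>SL2C\<^esub> x = \<one>\<^bsub>SL2C\<^esub>" if "x \<in> carrier SL2C" for x
    using that by (intro bexI[of _ "matrix_inv x"]) (auto simp: SL2C_inverse)
qed (auto simp: det_mul matrix_mul_assoc)

lemma inv_SL2C: "det A = 1 \<Longrightarrow> inv\<^bsub>SL2C\<^esub> A = matrix_inv A"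
  by (rule group.inv_equality[OF group_SL2C]) (auto simp: SL2C_inverse)

lemma matrix_inv_mult:
  fixes A B :: "complex^2^2"
  assumes "det A = 1" "det B = 1"
  shows "matrix_inv (A ** B) = matrix_inv B ** matrix_inv A"
  by (rule matrix_inv_unique) (simp add: matrix_mul_assoc SL2C_cancel SL2C_inverse assms)

lemma matrix_inv_inv: "det A = 1 \<Longrightarrow> matrix_inv (matrix_inv A) = A" for A :: "complex^2^2"
  by (rule matrix_inv_unique) (simp add: SL2C_inverse)

lemma matrix_inv_1 [simp]: "matrix_inv (mat 1 :: complex^'n^'n) = mat 1"
  by (rule matrix_inv_unique) simp

context
  fixes G assumes G: "subgroup G SL2C"
begin

lemma SL2C_sub_det: "g \<in> G \<Longrightarrow> det g = 1"
  using subgroup.subset[OF G] by auto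

lemma SL2C_sub_one: "mat 1 \<in> G"
  using subgroup.one_closed[OF G] by simp

lemma SL2C_sub_mult: "g \<in> G \<Longrightarrow> h \<in> G \<Longrightarrow> g ** h \<in> G"
  using subgroup.m_closed[OF G] by simp

lemma SL2C_sub_inv: "g \<in> G \<Longrightarrow> matrix_inv g \<in> G"
  using subgroup.m_inv_closed[OF G] by (metis inv_SL2C SL2C_sub_det)

end

section \<open>Eigenvalues of hyperbolic matrices\<close>

lemma matrix_vector_mult_2: "(A *v x) = vector [A$1$1 * x$1 + A$1$2 * x$2, A$2$1 * x$1 + A$2$2 * x$2]"
  for A :: "complex^2^2"
  by (simp add: vec_eq_iff forall_2 matrix_vector_mult_def sum_2)


text \<open>
  With determinant 1 the characteristic polynomial is determined by the trace, and its roots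
  are \<open>a\<close> and \<open>1/a\<close>. This turns questions on eigenvalues into questions on the trace, which
  is invariant under conjugation.
\<close>

lemma eigenvalue_iff_trace:
  fixes A :: "complex^2^2"
  assumes "det A = 1"
  shows "(\<exists>v. v \<noteq> 0 \<and> A *v v = a *s v) \<longleftrightarrow> a \<noteq> 0 \<and> trace A = a + inverse a"
proof -
  have "(\<exists>v. v \<noteq> 0 \<and> A *v v = a *s v) \<longleftrightarrow> (\<exists>v. v \<noteq> 0 \<and> (A - mat a) *v v = 0)"
  proof -
    have "mat a *v v = a *s v" for v :: "complex^2"
      by (simp add: vec_eq_iff forall_2 matrix_vector_mult_2 mat_def)
    then show ?thesis by (simp add: matrix_vector_mult_diff_rdistrib)
  qed
  also have "\<dots> \<longleftrightarrow> det (A - mat a) = 0"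
    using matrix_left_invertible_ker[of "A - mat a"] invertible_det_nz[of "A - mat a"]
    by (auto simp: invertible_left_inverse)
  also have "det (A - mat a) = 1 - a * trace A + a^2"
    using assms by (simp add: det_2 mat_def trace_def sum_2 algebra_simps power2_eq_square)
  also have "\<dots> = 0 \<longleftrightarrow> a \<noteq> 0 \<and> trace A = a + inverse a"
    by (cases "a = 0") (auto simp: field_simps power2_eq_square)
  finally show ?thesis .
qed

text \<open>
  A root of the characteristic polynomial on the unit circle has its conjugate as the other
  root, which makes the trace a real number between -2 and 2.
\<close>

lemma hyperbolic_imp_trace_eq:
  assumes "hyperbolic P"
  shows "\<exists>a. cmod a > 1 \<and> trace P = a + inverse a"
proof -
  define t where "t = trace P"
  define x where "x = (t + csqrt (t^2 - 4)) / 2"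
  have x2: "x^2 - t * x + 1 = 0"
  proof -
    have "2 * x - t = csqrt (t^2 - 4)" unfolding x_def by (simp add: field_simps)
    then have "(2 * x - t)^2 = t^2 - 4" by simp
    then have "4 * (x^2 - t * x + 1) = 0" by (simp add: power2_eq_square algebra_simps)
    then show ?thesis unfolding mult_eq_0_iff by simp
  qed
  then have x0: "x \<noteq> 0" by auto
  then have tx: "t = x + inverse x"
    using x2 by (simp add: field_simps power2_eq_square)
  have "cmod x \<noteq> 1"
  proof
    assume 1: "cmod x = 1"
    then have "inverse x = cnj x"
      using x0 complex_norm_square[of x] by (simp add: field_simps)
    then have "t = of_real (2 * Re x)"
      using tx complex_add_cnj by simp
    moreover have "\<bar>Re x\<bar> \<le> 1" using 1 abs_Re_le_cmod[of x] by simp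
    ultimately have "trace P \<in> complex_of_real ` {-2..2}"
      unfolding t_def by (intro image_eqI[of _ _ "2 * Re x"]) auto
    then show False using assms by (simp add: hyperbolic_def)
  qed
  then consider "cmod x > 1" | "cmod x < 1" by linarith
  then show ?thesis
  proof cases
    case 1 then show ?thesis using tx by (auto simp: t_def)
  next
    case 2
    then have "cmod (inverse x) > 1"
      using x0 by (simp add: norm_inverse one_less_inverse)
    then show ?thesis using tx by (intro exI[of _ "inverse x"]) (simp add: t_def)
  qed
qed

lemma eq_or_inverse_of_add_inverse_eq:
  fixes a b :: complex
  assumes "a + inverse a = b + inverse b" "a \<noteq> 0" "b \<noteq> 0"
  shows "b = a \<or> b = inverse a"
proof -
  have "(b - a) * (b - inverse a) = 0"
    using assms by (simp add: field_simps)
  then show ?thesis by auto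
qed

lemma hyperbolic_eigenvalue_eqI:
  assumes "det P = 1" "cmod a > 1" "trace P = a + inverse a"
  shows "hyperbolic_eigenvalue P = a"
  unfolding hyperbolic_eigenvalue_def eigenvalue_iff_trace[OF assms(1)]
proof (rule the_equality)
  show "1 < cmod a \<and> a \<noteq> 0 \<and> trace P = a + inverse a" using assms by auto
  fix b assume b: "1 < cmod b \<and> b \<noteq> 0 \<and> trace P = b + inverse b"
  then have "b = a \<or> b = inverse a"
    using assms by (intro eq_or_inverse_of_add_inverse_eq) auto
  moreover have "cmod (inverse a) < 1"
    using assms by (simp add: norm_inverse inverse_less_1_iff)
  ultimately show "b = a" using b by auto
qed

lemma hyperbolic_eigenvalue:
  assumes "det P = 1" "hyperbolic P"
  shows "cmod (hyperbolic_eigenvalue P) > 1"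
    "\<exists>v. v \<noteq> 0 \<and> P *v v = hyperbolic_eigenvalue P *s v"
proof -
  obtain a where a: "cmod a > 1" "trace P = a + inverse a"
    using hyperbolic_imp_trace_eq[OF assms(2)] by blast
  have e: "hyperbolic_eigenvalue P = a" by (rule hyperbolic_eigenvalue_eqI[OF assms(1) a])
  show "cmod (hyperbolic_eigenvalue P) > 1"
    using a e by simp
  show "\<exists>v. v \<noteq> 0 \<and> P *v v = hyperbolic_eigenvalue P *s v"
    unfolding eigenvalue_iff_trace[OF assms(1)] e using a by auto
qed

lemma trace_conj: "det (g::complex^2^2) = 1 \<Longrightarrow> trace (g ** P ** matrix_inv g) = trace P"
  using trace_mul_sym[of "g ** P" "matrix_inv g"] by (simp add: matrix_mul_assoc SL2C_inverse)

lemma det_conj: "det (g::complex^2^2) = 1 \<Longrightarrow> det (g ** P ** matrix_inv g) = det P"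
  by (simp add: det_mul SL2C_inverse(3))

lemma hyperbolic_conj: "det g = 1 \<Longrightarrow> hyperbolic (g ** P ** matrix_inv g) = hyperbolic P"
  by (simp add: hyperbolic_def trace_conj)

lemma hyperbolic_eigenvalue_conj:
  assumes "det g = 1" "det P = 1"
  shows "hyperbolic_eigenvalue (g ** P ** matrix_inv g) = hyperbolic_eigenvalue P"
  unfolding hyperbolic_eigenvalue_def
  using eigenvalue_iff_trace[of P] eigenvalue_iff_trace[of "g ** P ** matrix_inv g"] assms
  by (simp add: trace_conj det_conj)

text \<open>
  A matrix commuting with \<open>P\<close> preserves the eigenspaces of \<open>P\<close>. They are lines: two
  independent eigenvectors for \<open>a\<close> would make \<open>P\<close> the scalar matrix \<open>a\<close>, of determinant
  \<open>a * a\<close>.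
\<close>

lemma commute_eigenvector:
  fixes P g :: "complex^2^2"
  assumes "det P = 1" "a * a \<noteq> 1" "v \<noteq> 0" "P *v v = a *s v" "g ** P = P ** g"
  shows "\<exists>\<mu>. g *v v = \<mu> *s v"
proof -
  define u where "u = g *v v"
  have Pu: "P *v u = a *s u"
    unfolding u_def using assms by (simp add: matrix_vector_mul_assoc flip: assms(5))
      (simp add: vector_scalar_commute flip: matrix_vector_mul_assoc)
  have "v$1 * u$2 = v$2 * u$1"
  proof (rule ccontr)
    assume n: "v$1 * u$2 \<noteq> v$2 * u$1"
    define M :: "complex^2^2" where "M = vector [vector [v$1, u$1], vector [v$2, u$2]]"
    have "P ** M = mat a ** M"
      using Pu assms(4) unfolding M_def
      by (simp add: vec_eq_iff forall_2 matrix_matrix_mult_def sum_2 mat_def matrix_vector_mult_2)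
    moreover have "det (mat a :: complex^2^2) = a * a" by (simp add: det_2 mat_def)
    ultimately have "det P * det M = a * a * det M"
      using det_mul[of P M] det_mul[of "mat a" M] by metis
    moreover have "det M \<noteq> 0" using n by (simp add: M_def det_2 mult.commute)
    ultimately show False using assms by simp
  qed
  moreover from assms(3) have "v$1 \<noteq> 0 \<or> v$2 \<noteq> 0" by (auto simp: vec_eq_iff forall_2)
  ultimately have "u = (u$2 / v$2) *s v \<or> u = (u$1 / v$1) *s v"
    by (cases "v$1 = 0") (auto simp: vec_eq_iff forall_2 field_simps)
  then show ?thesis unfolding u_def by blast
qed

section \<open>Discreteness\<close>

lemma continuous_on_matrixI:
  fixes f :: "'a::topological_space \<Rightarrow> complex^'n^'m"
  assumes "\<And>i k. continuous_on X (\<lambda>p. f p $ i $ k)"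
  shows "continuous_on X f"
proof -
  have "continuous_on X (\<lambda>p. \<chi> i k. f p $ i $ k)"
    by (intro continuous_on_vec_lambda assms)
  then show ?thesis by simp
qed

lemma continuous_on_matrix_mult:
  fixes f :: "'a::topological_space \<Rightarrow> complex^'n^'m" and g :: "'a \<Rightarrow> complex^'k^'n"
  assumes "continuous_on X f" "continuous_on X g"
  shows "continuous_on X (\<lambda>p. f p ** g p)"
  unfolding matrix_matrix_mult_def
  by (intro continuous_on_vec_lambda continuous_on_sum continuous_on_mult
      continuous_on_component assms)

text \<open>
  At an accumulation point of \<open>G\<close>, quotients of distinct nearby elements of \<open>G\<close> would come
  arbitrarily close to the identity, which is isolated.
\<close>

lemma finite_discrete_Int_compact:
  assumes "discrete_subgroup_pm G" "compact K"
  shows "finite (G \<inter> K)"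
proof (rule ccontr)
  assume "infinite (G \<inter> K)"
  with \<open>compact K\<close> obtain l where l: "l \<in> K" "l islimpt (G \<inter> K)"
    unfolding compact_eq_Bolzano_Weierstrass by (meson inf_le2)
  have G: "subgroup G SL2C" "discrete G" using assms by (auto simp: discrete_subgroup_pm_def)
  have "l \<in> {A. det A = 1}"
  proof (rule closed_limpt[THEN iffD1, rule_format])
    show "closed {A :: complex^2^2. det A = 1}"
      unfolding det_2 by (intro closed_Collect_eq continuous_intros)
    show "l islimpt {A. det A = 1}"
      using l(2) by (rule islimpt_subset) (auto simp: SL2C_sub_det[OF G(1)])
  qed
  then have dl: "det l = 1" by simp
  from G(2) SL2C_sub_one[OF G(1)] have "mat 1 isolated_in G" by (rule discreteD)
  then obtain T where T: "open T" "T \<inter> G = {mat 1}" unfolding isolated_in_def by blast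
  define F :: "(complex^2^2) \<times> (complex^2^2) \<Rightarrow> complex^2^2"
    where "F = (\<lambda>(g, h). adj2 g ** h)"
  have "continuous_on UNIV adj2"
  proof (rule continuous_on_matrixI)
    fix i k :: 2
    show "continuous_on UNIV (\<lambda>A. adj2 A $ i $ k)"
      using exhaust_2[of i] exhaust_2[of k]
      by (elim disjE) (simp_all add: adj2_def, (intro continuous_intros)+)
  qed
  from continuous_on_compose2[OF this continuous_on_fst[OF continuous_on_id]]
  have cont: "continuous_on UNIV F"
    unfolding F_def split_def
    by (intro continuous_on_matrix_mult continuous_on_snd continuous_on_id) auto
  have "open (F -` T)" by (rule open_vimage[OF T(1) cont])
  moreover have "(l, l) \<in> F -` T"
    using T(2) matrix_inv_det1[OF dl] SL2C_inverse(2)[OF dl] by (auto simp: F_def)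
  ultimately obtain A B where AB: "open A" "open B" "l \<in> A" "l \<in> B" "A \<times> B \<subseteq> F -` T"
    by (auto elim!: open_prod_elim)
  obtain y where y: "y \<in> G \<inter> K" "y \<in> A" "y \<noteq> l"
    using islimptE[OF l(2) _ AB(1)] AB(3) by blast
  have "open (B - {y})" "l \<in> B - {y}" using AB y by auto
  then obtain z where z: "z \<in> G" "z \<in> B" "z \<noteq> y"
    using islimptE[OF l(2), of "B - {y}"] by blast
  have "F (y, z) \<in> T" using AB(5) y z by blast
  moreover have "F (y, z) = matrix_inv y ** z"
    using y G by (simp add: F_def matrix_inv_det1 SL2C_sub_det)
  moreover have "matrix_inv y ** z \<in> G"
    using y z SL2C_sub_mult[OF G(1)] SL2C_sub_inv[OF G(1)] by blast
  ultimately have "matrix_inv y ** z = mat 1" using T(2) by auto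
  then have "y ** (matrix_inv y ** z) = y" by simp
  then show False
    using z(3) y G by (simp add: matrix_mul_assoc SL2C_inverse SL2C_sub_det)
qed

section \<open>Translation lengths on the centralizer of a hyperbolic element\<close>

lemma norm_vector_scalar_mult: "norm (c *s v) = cmod c * norm v" for v :: "complex^'n"
  by (simp add: norm_vec_def L2_set_right_distrib norm_mult)

text \<open>
  If \<open>v\<close> is an eigenvector of \<open>g\<close>, this is the signed length of the translation by \<open>g\<close> along
  its axis in hyperbolic space. The factor 2 makes its absolute value the logarithm of the norm
  of \<open>g\<close>.
\<close>

definition transl_length :: "complex^2 \<Rightarrow> complex^2^2 \<Rightarrow> real" where
  "transl_length v g = 2 * ln (norm (g *v v) / norm v)"

lemma transl_length_eigen:
  assumes "v \<noteq> 0" "g *v v = \<mu> *s v"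
  shows "transl_length v g = 2 * ln (cmod \<mu>)"
  using assms by (simp add: transl_length_def norm_vector_scalar_mult)

locale hyperbolic_axis =
  fixes G :: "(complex^2^2) set" and P :: "complex^2^2" and a :: complex and v :: "complex^2"
  assumes disc: "discrete_subgroup_pm G" and P: "P \<in> G"
    and a: "cmod a > 1" and v: "v \<noteq> 0" and Pv: "P *v v = a *s v"
begin

abbreviation "C \<equiv> centralizer G P"
abbreviation "len \<equiv> transl_length v"

lemma G: "subgroup G SL2C"
  using disc by (simp add: discrete_subgroup_pm_def)

lemma detP: "det P = 1" by (rule SL2C_sub_det[OF G P])

lemma a_square_ne_1: "a * a \<noteq> 1"
proof
  assume "a * a = 1"
  then have "cmod a * cmod a = 1" by (metis norm_mult norm_one)
  moreover have "cmod a * cmod a > 1 * 1" using a by (intro mult_strict_mono) auto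
  ultimately show False by simp
qed

lemma traceP: "a \<noteq> 0" "trace P = a + inverse a"
  using eigenvalue_iff_trace[OF detP, of a] v Pv by blast+

lemma subgroup_C: "subgroup C SL2C"
proof (rule group.subgroupI[OF group_SL2C])
  show "C \<subseteq> carrier SL2C" by (auto simp: centralizer_def SL2C_sub_det[OF G])
  show "C \<noteq> {}" using SL2C_sub_one[OF G] by (auto simp: centralizer_def)
  fix g assume g: "g \<in> C"
  then have dg: "det g = 1" by (auto simp: centralizer_def SL2C_sub_det[OF G])
  have "matrix_inv g ** (g ** P) ** matrix_inv g = matrix_inv g ** (P ** g) ** matrix_inv g"
    using g by (simp add: centralizer_def)
  then have "P ** matrix_inv g = matrix_inv g ** P"
    by (simp add: matrix_mul_assoc SL2C_cancel SL2C_inverse dg)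
  then show "inv\<^bsub>SL2C\<^esub> g \<in> C"
    using g by (auto simp: centralizer_def inv_SL2C[OF dg] SL2C_sub_inv[OF G])
  fix h assume h: "h \<in> C"
  have "g ** h ** P = g ** (P ** h)"
    using h by (simp add: centralizer_def flip: matrix_mul_assoc)
  also have "\<dots> = P ** (g ** h)"
    using g by (simp add: centralizer_def matrix_mul_assoc)
  finally show "g \<otimes>\<^bsub>SL2C\<^esub> h \<in> C"
    using g h SL2C_sub_mult[OF G] by (auto simp: centralizer_def)
qed

lemmas C_det = SL2C_sub_det[OF subgroup_C] and C_one = SL2C_sub_one[OF subgroup_C]
  and C_mult = SL2C_sub_mult[OF subgroup_C] and C_inv = SL2C_sub_inv[OF subgroup_C]

lemma P_in_C: "P \<in> C"
  using P by (simp add: centralizer_def)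

lemma C_eigen:
  assumes "g \<in> C"
  obtains \<mu> where "\<mu> \<noteq> 0" "g *v v = \<mu> *s v" "len g = 2 * ln (cmod \<mu>)"
proof -
  have "g ** P = P ** g" using assms by (simp add: centralizer_def)
  then obtain \<mu> where \<mu>: "g *v v = \<mu> *s v"
    using commute_eigenvector[OF detP a_square_ne_1 v Pv] by blast
  moreover have "\<mu> \<noteq> 0"
    using eigenvalue_iff_trace[OF C_det[OF assms]] \<mu> v by blast
  ultimately show ?thesis using that transl_length_eigen[OF v \<mu>] by blast
qed

lemma len_mult:
  assumes "g \<in> C" "h \<in> C"
  shows "len (g ** h) = len g + len h"
proof -
  obtain \<mu> where \<mu>: "\<mu> \<noteq> 0" "g *v v = \<mu> *s v" "len g = 2 * ln (cmod \<mu>)" by (rule C_eigen[OF assms(1)])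
  obtain \<nu> where \<nu>: "\<nu> \<noteq> 0" "h *v v = \<nu> *s v" "len h = 2 * ln (cmod \<nu>)" by (rule C_eigen[OF assms(2)])
  have "(g ** h) *v v = (\<mu> * \<nu>) *s v"
    by (simp add: \<mu> \<nu> vector_scalar_commute mult.commute flip: matrix_vector_mul_assoc)
  from transl_length_eigen[OF v this] show ?thesis
    using \<mu> \<nu> by (simp add: norm_mult ln_mult)
qed

lemma len_one: "len (mat 1) = 0"
  using v by (simp add: transl_length_def)

lemma len_inv: "g \<in> C \<Longrightarrow> len (matrix_inv g) = - len g"
  using len_mult[of g "matrix_inv g"] C_inv[of g] by (simp add: SL2C_inverse C_det len_one)

lemma len_P: "len P > 0"
  using a ln_gt_zero[of "cmod a"] by (simp add: transl_length_eigen[OF v Pv])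

lemma C_pow: "g \<in> C \<Longrightarrow> g [^]\<^bsub>SL2C\<^esub> (n::nat) \<in> C \<and> len (g [^]\<^bsub>SL2C\<^esub> n) = n * len g"
  by (induction n) (auto simp: C_one len_one C_mult len_mult algebra_simps)

lemma C_int_pow:
  assumes "g \<in> C" shows "g [^]\<^bsub>SL2C\<^esub> (n::int) \<in> C \<and> len (g [^]\<^bsub>SL2C\<^esub> n) = n * len g"
proof (cases "n < 0")
  case False
  have e: "g [^]\<^bsub>SL2C\<^esub> n = g [^]\<^bsub>SL2C\<^esub> nat n"
    using False unfolding int_pow_def2 by (rule if_not_P)
  have "real (nat n) = of_int n" using False by simp
  then show ?thesis unfolding e using C_pow[OF assms, of "nat n"] by metis
next
  case True
  let ?h = "g [^]\<^bsub>SL2C\<^esub> nat (- n)"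
  have h: "?h \<in> C" "len ?h = nat (- n) * len g" using C_pow[OF assms] by blast+
  have "g [^]\<^bsub>SL2C\<^esub> n = matrix_inv ?h"
    unfolding int_pow_def2 if_P[OF True] by (rule inv_SL2C[OF C_det[OF h(1)]])
  moreover have "real (nat (- n)) = - of_int n" using True by simp
  ultimately show ?thesis
    using h(2) C_inv[OF h(1)] len_inv[OF h(1)] by (metis minus_mult_left minus_minus)
qed

text \<open>
  In a basis of eigenvectors of \<open>P\<close>, the elements of the centralizer are diagonal with entries
  \<open>\<mu>\<close> and \<open>1/\<mu>\<close>, so a bound on the length puts them into a compact set.
\<close>

lemma finite_bounded_length: "finite {g \<in> C. \<bar>len g\<bar> \<le> B}"
proof -
  have "trace P = inverse a + inverse (inverse a)" "inverse a \<noteq> 0" using traceP by auto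
  then obtain w where w: "w \<noteq> 0" "P *v w = inverse a *s w"
    using eigenvalue_iff_trace[OF detP, of "inverse a"] by blast
  have ia: "inverse a * inverse a \<noteq> 1" using a_square_ne_1 traceP(1) by (simp add: field_simps)
  define M :: "complex^2^2" where "M = vector [vector [v$1, w$1], vector [v$2, w$2]]"
  define D :: "complex \<times> complex \<Rightarrow> complex^2^2" where
    "D = (\<lambda>(\<mu>, \<nu>). vector [vector [\<mu>, 0], vector [0, \<nu>]])"
  have MD: "g ** M = M ** D (\<mu>, \<nu>)" if "g *v v = \<mu> *s v" "g *v w = \<nu> *s w" for g \<mu> \<nu>
    using that unfolding M_def D_def
    by (simp add: vec_eq_iff forall_2 matrix_matrix_mult_def sum_2 matrix_vector_mult_2)
  have detM: "det M \<noteq> 0"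
  proof
    assume "det M = 0"
    then have eq: "v$1 * w$2 = w$1 * v$2" by (simp add: M_def det_2)
    have "v $ 1 *s w = w $ 1 *s v" "v $ 2 *s w = w $ 2 *s v"
      using eq by (auto simp: vec_eq_iff forall_2 mult.commute)
    then have "\<exists>c d. c \<noteq> 0 \<and> c *s w = d *s v"
      using v by (auto simp: vec_eq_iff[of v] forall_2)
    then obtain c d where cd: "c \<noteq> 0" "c *s w = d *s v" by blast
    have "c *s (P *v w) = d *s (P *v v)"
      using arg_cong[OF cd(2), of "\<lambda>x. P *v x"] by (simp add: vector_scalar_commute)
    then have "inverse a *s (c *s w) = a *s (d *s v)"
      by (simp add: w Pv mult.commute)
    then have "(inverse a - a) *s (c *s w) = 0"
      by (metis cd(2) vec.scale_left_diff_distrib right_minus_eq)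
    then have "inverse a = a" using cd(1) w(1) by (simp only: vec.scale_eq_0_iff) auto
    then show False using a_square_ne_1 traceP(1) by (metis right_inverse)
  qed
  then obtain M' where M': "M ** M' = mat 1"
    using invertible_det_nz[of M] by (auto simp: invertible_def)
  define r where "r = exp (B / 2)"
  define K where "K = (\<lambda>p. M ** D p ** M') ` (cball 0 r \<times> cball 0 r)"
  have "continuous_on UNIV D"
  proof (rule continuous_on_matrixI)
    fix i k :: 2
    show "continuous_on UNIV (\<lambda>p. D p $ i $ k)"
      using exhaust_2[of i] exhaust_2[of k] unfolding D_def split_def
      by (elim disjE) (simp_all, (intro continuous_intros)+)
  qed
  then have "continuous_on (cball 0 r \<times> cball 0 r) (\<lambda>p. M ** D p ** M')"
    by (intro continuous_on_matrix_mult continuous_on_const) (rule continuous_on_subset, auto)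
  then have "compact K"
    unfolding K_def by (intro compact_continuous_image compact_Times compact_cball)
  moreover have "{g \<in> C. \<bar>len g\<bar> \<le> B} \<subseteq> G \<inter> K"
  proof safe
    fix g assume g: "g \<in> C" "\<bar>len g\<bar> \<le> B"
    then show "g \<in> G" by (simp add: centralizer_def)
    obtain \<mu> where \<mu>: "\<mu> \<noteq> 0" "g *v v = \<mu> *s v" "len g = 2 * ln (cmod \<mu>)" by (rule C_eigen[OF g(1)])
    have "g ** P = P ** g" using g by (simp add: centralizer_def)
    then obtain \<nu> where \<nu>: "g *v w = \<nu> *s w"
      using commute_eigenvector[OF detP ia w] by blast
    have gM: "g ** M = M ** D (\<mu>, \<nu>)" by (rule MD[OF \<mu>(2) \<nu>])
    have "det M = det M * (\<mu> * \<nu>)"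
      using arg_cong[OF gM, of det] C_det[OF g(1)] by (simp add: det_mul) (simp add: det_2 D_def)
    then have mn: "\<mu> * \<nu> = 1" using detM by simp
    have le: "cmod x \<le> r" if "x \<noteq> 0" "\<bar>2 * ln (cmod x)\<bar> \<le> B" for x
    proof -
      have "cmod x = exp (ln (cmod x))" using that by simp
      also have "\<dots> \<le> exp (B / 2)" using that by (subst exp_le_cancel_iff) linarith
      finally show ?thesis by (simp add: r_def)
    qed
    have "\<nu> = inverse \<mu>" using mn by (metis inverse_unique)
    then have "cmod \<nu> \<le> r" "cmod \<mu> \<le> r"
      using le[of \<mu>] le[of \<nu>] \<mu> g(2) by (auto simp: norm_inverse ln_inverse)
    moreover have "g = M ** D (\<mu>, \<nu>) ** M'"
      using gM M' by (metis matrix_mul_assoc matrix_mul_rid)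
    ultimately show "g \<in> K" unfolding K_def by (intro image_eqI[of _ _ "(\<mu>, \<nu>)"]) auto
  qed
  ultimately show ?thesis
    using finite_discrete_Int_compact[OF disc] finite_subset by blast
qed

text \<open>
  Torsion elements have length 0 as the reals are torsion-free; conversely the kernel of the
  length is a finite group.
\<close>

lemma tor_eq: "centralizer_tor G P = {g \<in> C. len g = 0}"
proof safe
  fix g assume g: "g \<in> centralizer_tor G P"
  then show gC: "g \<in> C" by (simp add: centralizer_tor_def)
  from g obtain n :: nat where "n > 0" "g [^]\<^bsub>SL2C\<^esub> n = mat 1"
    by (auto simp: centralizer_tor_def)
  then show "len g = 0" using C_pow[OF gC, of n] by (simp add: len_one)
next
  fix g assume g: "g \<in> C" "len g = 0"
  let ?K = "{g \<in> C. len g = 0}"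
  have fin: "finite ?K"
    using finite_bounded_length[of 0] by simp
  have sub: "subgroup ?K SL2C"
    by (rule group.subgroupI[OF group_SL2C])
      (auto intro!: exI[of _ "mat 1"] simp: C_det C_one len_one C_mult len_mult inv_SL2C C_inv len_inv)
  interpret K: group "SL2C\<lparr>carrier := ?K\<rparr>"
    by (rule subgroup.subgroup_is_group[OF sub group_SL2C])
  have "g [^]\<^bsub>SL2C\<^esub> (card ?K) = mat 1"
    using K.pow_order_eq_1[of g] g
    by (simp add: order_def flip: monoid.nat_pow_consistent[OF group.is_monoid[OF group_SL2C]])
  moreover have "card ?K > 0" using fin g by (auto simp: card_gt_0_iff)
  ultimately show "g \<in> centralizer_tor G P"
    using g by (auto simp: centralizer_tor_def)
qed


text \<open>
  The description in terms of lengths makes the choice of the generator irrelevant: since the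
  length has the torsion part as kernel, a complement of it is generated by any element whose
  length generates the image.
\<close>

lemma generates_centralizer_free_iff:
  "generates_centralizer_free G P q \<longleftrightarrow>
     q \<in> C \<and> len q \<noteq> 0 \<and> (\<forall>g\<in>C. \<exists>k::int. len g = k * len q)" (is "?lhs \<longleftrightarrow> ?rhs")
proof
  assume l: ?lhs
  then have q: "q \<in> C" by (simp add: generates_centralizer_free_def)
  have gen: "generate SL2C {q} = {q [^]\<^bsub>SL2C\<^esub> (k::int) | k. k \<in> UNIV}"
    using group.generate_pow[OF group_SL2C] C_det[OF q] by simp
  have tor: "generate SL2C {q} \<inter> centralizer_tor G P = {mat 1}"
    and inf: "infinite (generate SL2C {q})"
    and prod: "generate SL2C {q} <#>\<^bsub>SL2C\<^esub> centralizer_tor G P = C"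
    using l by (auto simp: generates_centralizer_free_def)
  have "len q \<noteq> 0"
  proof
    assume "len q = 0"
    then have "generate SL2C {q} \<subseteq> centralizer_tor G P"
      using C_int_pow[OF q] unfolding gen tor_eq by force
    then have "generate SL2C {q} \<subseteq> {mat 1}" using tor by blast
    then show False using inf finite_subset by blast
  qed
  moreover have "\<exists>k::int. len g = k * len q" if "g \<in> C" for g
  proof -
    from that have "g \<in> generate SL2C {q} <#>\<^bsub>SL2C\<^esub> centralizer_tor G P"
      by (simp only: prod)
    then obtain k :: int and t
      where kt: "g = q [^]\<^bsub>SL2C\<^esub> k ** t" "t \<in> centralizer_tor G P"
      unfolding gen set_mult_def by auto
    then have "len g = k * len q"
      using C_int_pow[OF q, of k] len_mult[of "q [^]\<^bsub>SL2C\<^esub> k" t] by (simp add: tor_eq)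
    then show ?thesis ..
  qed
  ultimately show ?rhs using q by blast
next
  assume r: ?rhs
  then have q: "q \<in> C" and q0: "len q \<noteq> 0" by auto
  have gen: "generate SL2C {q} = range (\<lambda>k::int. q [^]\<^bsub>SL2C\<^esub> k)"
    using group.generate_pow[OF group_SL2C] C_det[OF q] by auto
  have "inj (\<lambda>k::int. q [^]\<^bsub>SL2C\<^esub> k)"
  proof (rule injI)
    fix k l :: int assume "q [^]\<^bsub>SL2C\<^esub> k = q [^]\<^bsub>SL2C\<^esub> l"
    then have "k * len q = l * len q" using C_int_pow[OF q] by metis
    then show "k = l" using q0 by simp
  qed
  then have inf: "infinite (generate SL2C {q})"
    unfolding gen using finite_imageD infinite_UNIV_int by blast
  have tor: "generate SL2C {q} \<inter> centralizer_tor G P = {mat 1}"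
  proof -
    have "q [^]\<^bsub>SL2C\<^esub> k = mat 1" if "len (q [^]\<^bsub>SL2C\<^esub> k) = 0" for k :: int
    proof -
      have "k = 0" using that C_int_pow[OF q, of k] q0 by simp
      then show ?thesis by (metis int_pow_0 one_SL2C)
    qed
    moreover have "mat 1 \<in> generate SL2C {q}"
      using generate.one[of SL2C "{q}"] by simp
    ultimately show ?thesis
      using C_one len_one unfolding gen tor_eq by blast
  qed
  have "generate SL2C {q} <#>\<^bsub>SL2C\<^esub> centralizer_tor G P = C"
  proof (intro equalityI subsetI)
    fix g assume "g \<in> generate SL2C {q} <#>\<^bsub>SL2C\<^esub> centralizer_tor G P"
    then obtain k :: int and t
      where "g = q [^]\<^bsub>SL2C\<^esub> k ** t" "t \<in> centralizer_tor G P"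
      unfolding gen set_mult_def by auto
    then show "g \<in> C" using C_int_pow[OF q] C_mult tor_eq by blast
  next
    fix g assume g: "g \<in> C"
    then obtain k :: int where k: "len g = k * len q" using r by blast
    let ?p = "q [^]\<^bsub>SL2C\<^esub> k"
    have p: "?p \<in> C" "len ?p = k * len q" using C_int_pow[OF q] by auto
    define t where "t = matrix_inv ?p ** g"
    have "t \<in> centralizer_tor G P"
      unfolding tor_eq t_def using p g k by (simp add: C_mult C_inv len_mult len_inv)
    moreover have "g = ?p ** t"
      unfolding t_def using C_det[OF p(1)] by (simp add: matrix_mul_assoc SL2C_inverse)
    ultimately show "g \<in> generate SL2C {q} <#>\<^bsub>SL2C\<^esub> centralizer_tor G P"
      unfolding gen set_mult_def by auto
  qed
  then show ?lhs
    using q inf tor by (simp add: generates_centralizer_free_def)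
qed

text \<open>
  A generator is an element of least positive length; one exists because only finitely many
  elements are not longer than \<open>P\<close>.
\<close>

lemma exists_generator: "\<exists>q. generates_centralizer_free G P q"
proof -
  let ?S = "{g \<in> C. 0 < len g \<and> len g \<le> len P}"
  have "finite ?S" by (rule finite_subset[OF _ finite_bounded_length[of "len P"]]) auto
  moreover have "?S \<noteq> {}" using P_in_C len_P by blast
  ultimately have "Min (len ` ?S) \<in> len ` ?S" and Min: "\<And>g. g \<in> ?S \<Longrightarrow> Min (len ` ?S) \<le> len g"
    by (intro Min_in Min_le finite_imageI imageI; blast)+
  then obtain q where "q \<in> ?S" "Min (len ` ?S) = len q" by blast
  with Min have q: "q \<in> ?S" "\<And>g. g \<in> ?S \<Longrightarrow> len q \<le> len g" by simp_all
  then have qC: "q \<in> C" "len q > 0" by auto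
  have min: "len q \<le> len g" if "g \<in> C" "len g > 0" for g
    using q that by fastforce
  have "\<exists>k::int. len g = k * len q" if g: "g \<in> C" for g
  proof -
    define k where "k = \<lfloor>len g / len q\<rfloor>"
    let ?p = "q [^]\<^bsub>SL2C\<^esub> k"
    have p: "?p \<in> C" "len ?p = k * len q" using C_int_pow[OF qC(1)] by auto
    define h where "h = matrix_inv ?p ** g"
    have h: "h \<in> C" "len h = len g - k * len q"
      unfolding h_def using p g by (simp_all add: C_mult C_inv len_mult len_inv)
    have "k * len q \<le> len g" "len g < (k + 1) * len q"
      using floor_divide_lower[OF qC(2), of "len g"] floor_divide_upper[OF qC(2), of "len g"]
      unfolding k_def by simp_all
    then have "0 \<le> len h" "len h < len q" using h by (simp_all add: algebra_simps)
    then have "len h = 0" using min[OF h(1)] by linarith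
    then show ?thesis using h(2) by auto
  qed
  then show ?thesis
    unfolding generates_centralizer_free_iff using qC by auto
qed

lemma primitive_element:
  "primitive_element G P \<in> C" "len (primitive_element G P) \<noteq> 0"
  "g \<in> C \<Longrightarrow> \<exists>k::int. len g = k * len (primitive_element G P)"
proof -
  have "generates_centralizer_free G P (primitive_element G P)"
    unfolding primitive_element_def by (rule someI_ex[OF exists_generator])
  then show "primitive_element G P \<in> C" "len (primitive_element G P) \<noteq> 0"
    "g \<in> C \<Longrightarrow> \<exists>k::int. len g = k * len (primitive_element G P)"
    unfolding generates_centralizer_free_iff by blast+
qed

lemma ln_hyperbolic_norm:
  assumes "g \<in> C" "len g \<noteq> 0"
  shows "ln (hyperbolic_norm g) = \<bar>len g\<bar>"
proof -
  obtain \<mu> where \<mu>: "\<mu> \<noteq> 0" "g *v v = \<mu> *s v" "len g = 2 * ln (cmod \<mu>)" by (rule C_eigen[OF assms(1)])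
  have dg: "det g = 1" by (rule C_det[OF assms(1)])
  have tr: "trace g = \<mu> + inverse \<mu>" using eigenvalue_iff_trace[OF dg] \<mu> v by blast
  have "cmod \<mu> \<noteq> 1" using \<mu> assms(2) by auto
  then consider "cmod \<mu> > 1" | "cmod \<mu> < 1" by linarith
  then show ?thesis
  proof cases
    case 1
    then have "hyperbolic_eigenvalue g = \<mu>" using tr by (intro hyperbolic_eigenvalue_eqI[OF dg])
    then show ?thesis using 1 \<mu> ln_gt_zero[OF 1] by (simp add: hyperbolic_norm_def ln_realpow)
  next
    case 2
    then have "cmod (inverse \<mu>) > 1" using \<mu>(1) by (simp add: norm_inverse one_less_inverse)
    then have e: "hyperbolic_eigenvalue g = inverse \<mu>"
      using tr by (intro hyperbolic_eigenvalue_eqI[OF dg]) auto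
    have "ln (cmod \<mu>) < 0" using 2 \<mu>(1) by simp
    then show ?thesis using \<mu> by (simp add: e hyperbolic_norm_def ln_realpow norm_inverse ln_inverse)
  qed
qed

definition period :: real where
  "period = ln (hyperbolic_norm (primitive_element G P))"

lemma period_eq: "period = \<bar>len (primitive_element G P)\<bar>"
  unfolding period_def by (intro ln_hyperbolic_norm primitive_element)

lemma period_pos: "period > 0"
  using primitive_element(2) by (simp add: period_eq)

lemma len_multiple:
  assumes "g \<in> C" shows "\<exists>k::int. len g = k * period"
proof -
  let ?q = "primitive_element G P"
  obtain k :: int where "len g = k * len ?q" using primitive_element(3)[OF assms] by blast
  then have "len g = (if len ?q > 0 then k else - k) * period"
    by (auto simp: period_eq)
  then show ?thesis ..
qed

lemma len_surj: "\<exists>g\<in>C. len g = k * period" for k :: int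
proof -
  let ?q = "primitive_element G P"
  let ?k = "if len ?q > 0 then k else - k"
  have "?k * len ?q = k * period" by (auto simp: period_eq)
  then show ?thesis using C_int_pow[OF primitive_element(1), of ?k] by metis
qed

lemma finite_window: "finite {g \<in> C. t \<le> len g \<and> len g < u}"
  by (rule finite_subset[OF _ finite_bounded_length[of "\<bar>t\<bar> + \<bar>u\<bar>"]]) auto

lemma finite_tor: "finite (centralizer_tor G P)"
  unfolding tor_eq using finite_bounded_length[of 0] by simp

lemma card_tor_pos: "card (centralizer_tor G P) > 0"
  using finite_tor C_one len_one by (auto simp: card_gt_0_iff tor_eq)

text \<open>
  The window contains exactly one multiple of the period, and the elements of that length form
  a coset of the torsion part.
\<close>

lemma card_window:
  "card {g \<in> C. t \<le> len g \<and> len g < t + period} = card (centralizer_tor G P)"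
proof -
  define k where "k = \<lceil>t / period\<rceil>"
  have "t / period \<le> k" "k < t / period + 1"
    unfolding k_def using ceiling_correct[of "t / period"] by linarith+
  then have k: "t \<le> k * period" "k * period < t + period"
    using period_pos by (simp_all add: field_simps)
  have eq: "{g \<in> C. t \<le> len g \<and> len g < t + period} = {g \<in> C. len g = k * period}"
  proof safe
    fix g assume g: "g \<in> C" "t \<le> len g" "len g < t + period"
    then obtain l :: int where l: "len g = l * period" using len_multiple by blast
    have "l * period < (k + 1) * period" "k * period < (l + 1) * period"
      using g l k by (auto simp: algebra_simps)
    then have "l < k + 1" "k < l + 1"
      using period_pos by (auto simp: mult_less_cancel_right simp flip: of_int_less_iff[where 'a = real])
    then show "len g = k * period" using l by simp
  qed (use k in auto)
  obtain p where p: "p \<in> C" "len p = k * period" using len_surj by blast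
  have "bij_betw (\<lambda>t. p ** t) (centralizer_tor G P) {g \<in> C. len g = k * period}"
    unfolding tor_eq
    by (rule bij_betwI[where g = "\<lambda>g. matrix_inv p ** g"])
      (use p in \<open>auto simp: C_mult C_inv len_mult len_inv matrix_mul_assoc SL2C_inverse C_det\<close>)
  then show ?thesis unfolding eq by (simp add: bij_betw_same_card)
qed

lemma card_window_multiple:
  "card {g \<in> C. t \<le> len g \<and> len g < t + real n * period} = n * card (centralizer_tor G P)"
proof (induction n)
  case 0
  have "{g \<in> C. t \<le> len g \<and> len g < t} = {}" by auto
  then show ?case by (simp only: of_nat_0 mult_zero_left add_0_right card.empty)
next
  case (Suc n)
  let ?A = "{g \<in> C. t \<le> len g \<and> len g < t + real n * period}"
  let ?B = "{g \<in> C. t + real n * period \<le> len g \<and> len g < t + real n * period + period}"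
  have "0 \<le> real n * period" using period_pos by simp
  then have "{g \<in> C. t \<le> len g \<and> len g < t + real (Suc n) * period} = ?A \<union> ?B"
    using period_pos by (auto simp: algebra_simps intro: order_trans[of t "t + real n * period"])
  moreover have "card (?A \<union> ?B) = card ?A + card ?B"
    by (rule card_Un_disjoint) (auto simp: finite_window)
  ultimately show ?case using Suc card_window[of "t + real n * period"] by simp
qed

end

section \<open>Counting conjugates in the subgroup\<close>

definition conj_by :: "complex^2^2 \<Rightarrow> complex^2^2 \<Rightarrow> complex^2^2" where
  "conj_by g P = g ** P ** matrix_inv g"

lemma conj_by_mult:
  "det g = 1 \<Longrightarrow> det h = 1 \<Longrightarrow> conj_by (g ** h) P = conj_by g (conj_by h P)"
  by (simp add: conj_by_def matrix_inv_mult matrix_mul_assoc)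

lemma conj_by_one [simp]: "conj_by (mat 1) P = P"
  by (simp add: conj_by_def)

lemma conj_by_inv [simp]:
  assumes "det g = 1"
  shows "conj_by g (conj_by (matrix_inv g) P) = P" "conj_by (matrix_inv g) (conj_by g P) = P"
  using assms by (simp_all add: SL2C_inverse flip: conj_by_mult)

lemma centralizer_iff:
  assumes "subgroup G SL2C"
  shows "g \<in> centralizer G P \<longleftrightarrow> g \<in> G \<and> conj_by g P = P"
proof -
  have "g ** P = P ** g \<longleftrightarrow> conj_by g P = P" if "g \<in> G"
  proof
    have d: "det g = 1" by (rule SL2C_sub_det[OF assms that])
    show "conj_by g P = P" if "g ** P = P ** g"
      using that d by (simp add: conj_by_def SL2C_cancel)
    show "g ** P = P ** g" if "conj_by g P = P"
      using arg_cong[OF that, of "\<lambda>A. A ** g"] d by (simp add: conj_by_def SL2C_cancel)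
  qed
  then show ?thesis by (auto simp: centralizer_def)
qed

lemma conj_class_eq: "conj_class G P = (\<lambda>g. conj_by g P) ` G"
  by (simp add: conj_class_def conj_by_def)

lemma transl_length_conj_by:
  assumes "det g = 1" "v \<noteq> 0" "c *v v = \<mu> *s v"
  shows "transl_length (g *v v) (conj_by g c) = transl_length v c" and "g *v v \<noteq> 0"
    and "conj_by g c *v (g *v v) = \<mu> *s (g *v v)"
proof -
  have "matrix_inv g *v (g *v v) = v"
    by (simp add: matrix_vector_mul_assoc SL2C_inverse assms)
  then show nz: "g *v v \<noteq> 0" using assms(2) by (metis matrix_vector_mult_0_right)
  have "conj_by g c *v (g *v v) = g *v (c *v v)"
    by (simp add: conj_by_def matrix_vector_mul_assoc SL2C_cancel assms(1))
  then show eig: "conj_by g c *v (g *v v) = \<mu> *s (g *v v)"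
    by (simp add: assms vector_scalar_commute)
  show "transl_length (g *v v) (conj_by g c) = transl_length v c"
    using transl_length_eigen[OF nz eig] transl_length_eigen[OF assms(2,3)] by simp
qed

definition right_transversal ::
  "(complex^2^2) set \<Rightarrow> (complex^2^2) set \<Rightarrow> (complex^2^2) set \<Rightarrow> bool" where
  "right_transversal K G R \<longleftrightarrow> R \<subseteq> G \<and> (\<forall>x\<in>G. \<exists>!r. r \<in> R \<and> x ** matrix_inv r \<in> K)"

lemma right_transversal_exists:
  assumes K: "subgroup K SL2C" and G: "subgroup G SL2C" and "K \<subseteq> G" "finite_index K G"
  obtains R where "finite R" "right_transversal K G R"
proof -
  define co :: "complex^2^2 \<Rightarrow> (complex^2^2) set" where "co = (\<lambda>x. (\<lambda>k. k ** x) ` K)"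
  have rc: "rcosets\<^bsub>SL2C\<lparr>carrier := G\<rparr>\<^esub> K = co ` G"
    by (auto simp: RCOSETS_def r_coset_def co_def)
  have co_iff: "co x = co y \<longleftrightarrow> x ** matrix_inv y \<in> K" if "x \<in> G" "y \<in> G" for x y
  proof
    have d: "det x = 1" "det y = 1" using that SL2C_sub_det[OF G] by auto
    have "x \<in> co x" unfolding co_def using SL2C_sub_one[OF K] by (intro image_eqI[of _ _ "mat 1"]) auto
    moreover assume "co x = co y"
    ultimately obtain k where "k \<in> K" "x = k ** y" by (auto simp: co_def)
    then show "x ** matrix_inv y \<in> K" by (simp add: SL2C_cancel d)
  next
    assume k: "x ** matrix_inv y \<in> K"
    have d: "det x = 1" "det y = 1" using that SL2C_sub_det[OF G] by auto
    have "h ** x \<in> co y" if "h \<in> K" for h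
      unfolding co_def using SL2C_sub_mult[OF K that k]
      by (rule image_eqI[rotated]) (simp add: matrix_mul_assoc SL2C_cancel d)
    moreover have "h ** y \<in> co x" if "h \<in> K" for h
      unfolding co_def using SL2C_sub_mult[OF K that SL2C_sub_inv[OF K k]]
      by (rule image_eqI[rotated])
        (simp add: matrix_inv_mult matrix_inv_inv SL2C_inverse matrix_mul_assoc SL2C_cancel d)
    ultimately show "co x = co y" unfolding co_def by blast
  qed
  define R where "R = inv_into G co ` (co ` G)"
  have "right_transversal K G R"
    unfolding right_transversal_def
  proof (intro conjI ballI)
    show sub: "R \<subseteq> G" unfolding R_def by (auto intro: inv_into_into)
    fix x assume x: "x \<in> G"
    let ?r = "inv_into G co (co x)"
    have r: "?r \<in> R" "co ?r = co x" using x by (auto simp: R_def f_inv_into_f)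
    show "\<exists>!r. r \<in> R \<and> x ** matrix_inv r \<in> K"
    proof (rule ex1I[of _ ?r])
      show "?r \<in> R \<and> x ** matrix_inv ?r \<in> K"
        using r sub x co_iff by (metis subsetD)
      fix r assume r': "r \<in> R \<and> x ** matrix_inv r \<in> K"
      then have "co x = co r" using sub x co_iff by blast
      moreover obtain y where "y \<in> G" "r = inv_into G co (co y)" using r' by (auto simp: R_def)
      ultimately show "r = ?r" by (simp add: f_inv_into_f)
    qed
  qed
  moreover have "finite R"
    using assms(4) unfolding R_def finite_index_def rc by simp
  ultimately show ?thesis using that by blast
qed

locale group_pair =
  fixes K G :: "(complex^2^2) set" and R
  assumes K: "discrete_subgroup_pm K" and G: "discrete_subgroup_pm G" and KG: "K \<subseteq> G"
    and finR: "finite R" and R: "right_transversal K G R"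
begin

lemma sK: "subgroup K SL2C" and sG: "subgroup G SL2C"
  using K G by (auto simp: discrete_subgroup_pm_def)

lemmas detK = SL2C_sub_det[OF sK] and detG = SL2C_sub_det[OF sG]
  and invK = SL2C_sub_inv[OF sK] and invG = SL2C_sub_inv[OF sG]
  and multK = SL2C_sub_mult[OF sK] and multG = SL2C_sub_mult[OF sG]

lemma RG: "r \<in> R \<Longrightarrow> r \<in> G"
  using R by (auto simp: right_transversal_def)

lemma rep_exists: "x \<in> G \<Longrightarrow> \<exists>r\<in>R. x ** matrix_inv r \<in> K"
  using R unfolding right_transversal_def by blast

lemma rep_unique:
  "x \<in> G \<Longrightarrow> r \<in> R \<Longrightarrow> s \<in> R \<Longrightarrow> x ** matrix_inv r \<in> K \<Longrightarrow> x ** matrix_inv s \<in> K \<Longrightarrow> r = s"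
  using R unfolding right_transversal_def by blast

lemma mem_K_iff: "k \<in> K \<Longrightarrow> det x = 1 \<Longrightarrow> x ** k \<in> K \<longleftrightarrow> x \<in> K"
  using multK invK by (metis SL2C_cancel(1) detK)

text \<open>
  The set counted on the left is a set of representatives of those cosets \<open>K r\<close> for which
  \<open>r\<close> conjugates \<open>P\<close> into the class of \<open>Q\<close> in \<open>K\<close>. They are the cosets \<open>K x c\<close> with \<open>c\<close> in
  the centralizer of \<open>P\<close> in \<open>G\<close>, so there are as many as the index of the centralizers of
  \<open>Q\<close>. To compare it with the two periods, count the set \<open>X\<close> of elements \<open>c\<close> with length in
  one window of the period of \<open>Q\<close>. That period is a multiple of the period of \<open>P\<close>, which
  gives the cardinality of \<open>X\<close> by \<open>card_window_multiple\<close>. On the other hand, the elements of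
  \<open>X\<close> belonging to one coset correspond to a window in the centralizer of \<open>Q\<close>.
\<close>

lemma count_conjugates:
  assumes P: "P \<in> G" "hyperbolic P" and Q: "Q \<in> K" "Q = conj_by x P" and x: "x \<in> G"
  shows "card {r \<in> R. conj_by r P \<in> conj_class K Q} * card (centralizer_tor K Q) *
      ln (hyperbolic_norm (primitive_element G P)) =
    card (centralizer_tor G P) * ln (hyperbolic_norm (primitive_element K Q))"
proof -
  define a where "a = hyperbolic_eigenvalue P"
  have dP: "det P = 1" and dx: "det x = 1" using P x detG by auto
  obtain v where v: "v \<noteq> 0" "P *v v = a *s v" and a: "cmod a > 1"
    using hyperbolic_eigenvalue[OF dP P(2)] unfolding a_def by blast
  interpret P: hyperbolic_axis G P a v
    by unfold_locales (use G P v a in auto)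
  define w where "w = x *v v"
  interpret Q: hyperbolic_axis K Q a w
    by unfold_locales (use K Q a transl_length_conj_by[OF dx v] in \<open>auto simp: w_def\<close>)
  have lenQ: "Q.len (conj_by x c) = P.len c" if c: "c \<in> P.C" for c
  proof -
    obtain \<mu> where "c *v v = \<mu> *s v" by (rule P.C_eigen[OF c])
    then show ?thesis unfolding w_def by (rule transl_length_conj_by[OF dx v(1)])
  qed
  have PC: "c \<in> P.C \<longleftrightarrow> c \<in> G \<and> conj_by c P = P" for c by (rule centralizer_iff[OF sG])
  have QC: "c \<in> Q.C \<longleftrightarrow> c \<in> K \<and> conj_by c Q = Q" for c by (rule centralizer_iff[OF sK])
  have comm: "conj_by c P = P \<longleftrightarrow> conj_by (conj_by x c) Q = Q" if "det c = 1" for c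
  proof -
    have "conj_by (conj_by x c) Q = conj_by x (conj_by c P)"
      using that dx by (simp add: Q(2) conj_by_def[of x c] conj_by_mult SL2C_inverse det_mul)
    then show ?thesis using dx by (metis Q(2) conj_by_inv(2))
  qed
  have conjG: "conj_by x c \<in> G" "conj_by (matrix_inv x) c \<in> G" if "c \<in> G" for c
    using that x multG invG by (auto simp: conj_by_def)
  have Q_to_P: "conj_by (matrix_inv x) g \<in> P.C" if g: "g \<in> Q.C" for g
    using g KG conjG(2)[of g] comm[of "conj_by (matrix_inv x) g"] dx detG by (auto simp: PC QC)

  obtain n :: nat where n: "Q.period = n * P.period"
  proof -
    obtain g where g: "g \<in> Q.C" "Q.len g = Q.period" using Q.len_surj[of 1] by auto
    let ?c = "conj_by (matrix_inv x) g"
    have c: "?c \<in> P.C" by (rule Q_to_P[OF g(1)])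
    then have "P.len ?c = Q.period" using lenQ[OF c] g dx by simp
    then obtain k :: int where k: "Q.period = k * P.period" using P.len_multiple[OF c] by auto
    then have "k > 0" using P.period_pos Q.period_pos by (metis of_int_0_less_iff zero_less_mult_pos2)
    then have "Q.period = real (nat k) * P.period" using k by simp
    then show ?thesis by (rule that)
  qed

  define X where "X = {c \<in> P.C. 0 \<le> P.len c \<and> P.len c < Q.period}"
  define S where "S = {r \<in> R. conj_by r P \<in> conj_class K Q}"
  define Xr where "Xr = (\<lambda>r. {c \<in> X. (x ** c) ** matrix_inv r \<in> K})"
  have X1: "card X = n * card (centralizer_tor G P)"
    using P.card_window_multiple[of 0 n] unfolding X_def n by simp
  have XG: "x ** c \<in> G" "det c = 1" "conj_by c P = P" if "c \<in> X" for c
    using that x multG P.C_det by (auto simp: X_def PC)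
  have finX: "finite X" unfolding X_def by (rule P.finite_window)
  have XU: "X = (\<Union>r\<in>S. Xr r)"
  proof (intro equalityI subsetI)
    fix c assume c: "c \<in> X"
    obtain r where r: "r \<in> R" "(x ** c) ** matrix_inv r \<in> K"
      using rep_exists[OF XG(1)[OF c]] by blast
    define k where "k = (x ** c) ** matrix_inv r"
    have dr: "det r = 1" using RG[OF r(1)] detG by auto
    have k: "k \<in> K" "det k = 1" using r detK by (auto simp: k_def)
    have "k ** r = x ** c" by (simp add: k_def SL2C_cancel dr)
    then have "conj_by k (conj_by r P) = Q"
      using XG[OF c] k dr dx by (metis Q(2) conj_by_mult)
    then have "conj_by r P = conj_by (matrix_inv k) Q" using k by auto
    then have "r \<in> S" using r invK[OF k(1)] by (auto simp: S_def conj_class_eq)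
    then show "c \<in> (\<Union>r\<in>S. Xr r)" using c r by (auto simp: Xr_def)
  qed (auto simp: Xr_def)
  have cardXr: "card (Xr r) = card (centralizer_tor K Q)" if r: "r \<in> S" for r
  proof -
    have rR: "r \<in> G" "det r = 1" using r RG detG by (auto simp: S_def)
    obtain k where k: "k \<in> K" "conj_by r P = conj_by k Q"
      using r by (auto simp: S_def conj_class_eq)
    have dk: "det k = 1" using k detK by auto
    \<comment> \<open>one element of the fibre; the others differ from it by the centralizer of \<open>Q\<close> in \<open>K\<close>\<close>
    define c0 where "c0 = matrix_inv x ** matrix_inv k ** r"
    have c0: "c0 \<in> P.C"
    proof -
      have "conj_by c0 P = conj_by (matrix_inv x) (conj_by (matrix_inv k) (conj_by r P))"
        unfolding c0_def using dx dk rR by (simp add: conj_by_mult SL2C_inverse det_mul)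
      also have "\<dots> = P" using k(2) dk dx by (simp add: Q(2))
      finally show ?thesis
        unfolding PC c0_def using invG[OF x] invG[of k] k KG multG rR by blast
    qed
    have dc0: "det c0 = 1" by (rule P.C_det[OF c0])
    have K_iff: "conj_by x (c ** matrix_inv c0) \<in> K \<longleftrightarrow> (x ** c) ** matrix_inv r \<in> K"
      if "det c = 1" for c
    proof -
      have "conj_by x (c ** matrix_inv c0) = ((x ** c) ** matrix_inv r) ** k"
        unfolding conj_by_def c0_def using dx dk rR
        by (simp add: matrix_inv_mult matrix_inv_inv SL2C_inverse det_mul matrix_mul_assoc SL2C_cancel)
      moreover have "det ((x ** c) ** matrix_inv r) = 1"
        using that dx rR by (simp add: det_mul SL2C_inverse)
      ultimately show ?thesis using mem_K_iff[OF k(1)] by simp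
    qed
    let ?W = "{g \<in> Q.C. - P.len c0 \<le> Q.len g \<and> Q.len g < - P.len c0 + Q.period}"
    have "bij_betw (\<lambda>c. conj_by x (c ** matrix_inv c0)) (Xr r) ?W"
    proof (rule bij_betwI[where g = "\<lambda>g. conj_by (matrix_inv x) g ** c0"])
      show "(\<lambda>c. conj_by x (c ** matrix_inv c0)) \<in> Xr r \<rightarrow> ?W"
      proof
        fix c assume c: "c \<in> Xr r"
        then have cX: "c \<in> X" "c \<in> P.C" by (auto simp: Xr_def X_def)
        have cc: "c ** matrix_inv c0 \<in> P.C" using P.C_mult P.C_inv cX c0 by blast
        have "conj_by x (c ** matrix_inv c0) \<in> K"
          using c K_iff[OF XG(2)[OF cX(1)]] by (simp add: Xr_def)
        moreover have "conj_by (conj_by x (c ** matrix_inv c0)) Q = Q"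
          using cc comm[OF P.C_det[OF cc]] by (simp add: PC)
        moreover have "Q.len (conj_by x (c ** matrix_inv c0)) = P.len c - P.len c0"
          using lenQ[OF cc] P.len_mult[OF cX(2) P.C_inv[OF c0]] P.len_inv[OF c0] by simp
        ultimately show "conj_by x (c ** matrix_inv c0) \<in> ?W"
          using cX(1) by (auto simp: QC X_def)
      qed
      show "(\<lambda>g. conj_by (matrix_inv x) g ** c0) \<in> ?W \<rightarrow> Xr r"
      proof
        fix g assume g: "g \<in> ?W"
        let ?c = "conj_by (matrix_inv x) g"
        have c: "?c \<in> P.C" using Q_to_P g by blast
        have "P.len ?c = Q.len g" using lenQ[OF c] dx by simp
        then have "P.len (?c ** c0) = Q.len g + P.len c0" using P.len_mult[OF c c0] by simp
        then have cX: "?c ** c0 \<in> X" using P.C_mult[OF c c0] g by (simp add: X_def)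
        have "?c ** c0 ** matrix_inv c0 = ?c" by (simp add: SL2C_cancel dc0)
        then have "conj_by x (?c ** c0 ** matrix_inv c0) \<in> K" using g dx by (simp add: QC)
        then show "?c ** c0 \<in> Xr r"
          using cX K_iff[OF XG(2)[OF cX]] by (simp add: Xr_def)
      qed
      show "conj_by (matrix_inv x) (conj_by x (c ** matrix_inv c0)) ** c0 = c" for c
        using dx dc0 by (simp add: SL2C_cancel)
      show "conj_by x (conj_by (matrix_inv x) g ** c0 ** matrix_inv c0) = g" for g
        using dx dc0 by (simp add: SL2C_cancel)
    qed
    then have "card (Xr r) = card ?W" by (rule bij_betw_same_card)
    then show ?thesis using Q.card_window[of "- P.len c0"] by simp
  qed
  have "card X = (\<Sum>r\<in>S. card (Xr r))"
    unfolding XU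
  proof (rule card_UN_disjoint)
    show "finite S" using finR by (simp add: S_def)
    show "\<forall>r\<in>S. finite (Xr r)"
      using finX by (simp add: Xr_def)
    show "\<forall>r\<in>S. \<forall>s\<in>S. r \<noteq> s \<longrightarrow> Xr r \<inter> Xr s = {}"
      using rep_unique XG(1) by (fastforce simp: Xr_def S_def)
  qed
  then have "card X = card S * card (centralizer_tor K Q)" using cardXr by simp
  then have "real (card S * card (centralizer_tor K Q)) = n * card (centralizer_tor G P)"
    using X1 by simp
  then show ?thesis
    using n unfolding S_def P.period_def Q.period_def by (simp add: algebra_simps)
qed

end

section \<open>The trace of an induced representation\<close>

lemma linear_functional_expansion:
  fixes \<phi> :: "complex^'m \<Rightarrow> complex"
  assumes add: "\<And>u v. \<phi> (u + v) = \<phi> u + \<phi> v" and scale: "\<And>c v. \<phi> (c *s v) = c * \<phi> v"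
  shows "\<phi> u = (\<Sum>j\<in>UNIV. u $ j * \<phi> (axis j 1))"
proof -
  have zero: "\<phi> 0 = 0" using scale[of 0 0] by simp
  have "\<phi> (\<Sum>j\<in>J. f j) = (\<Sum>j\<in>J. \<phi> (f j))" if "finite J" for J :: "'m set" and f
    using that by induction (auto simp: zero add)
  then have "\<phi> (\<Sum>j\<in>UNIV. u $ j *s axis j 1) = (\<Sum>j\<in>UNIV. u $ j * \<phi> (axis j 1))"
    by (simp add: scale)
  then show ?thesis by (simp only: basis_expansion)
qed

lemma matrix_vector_mult_axis: "(A *v axis j 1) $ i = A $ i $ j"
  for A :: "complex^'n^'m"
  by (simp add: matrix_vector_mult_def axis_def if_distrib cong: if_cong)

text \<open>
  The trace of \<open>A\<close> composed with the identity, written as a sum of operators of rank one. A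
  spanning family with coordinate functionals suffices for this, so for the induced
  representation the size of the index type \<open>'m\<close> never has to be compared with the dimension
  of the space of functions.
\<close>

lemma trace_dual_frame:
  fixes A :: "complex^'m^'m" and \<phi> :: "'i \<Rightarrow> complex^'m \<Rightarrow> complex"
  assumes add: "\<And>i u v. i \<in> I \<Longrightarrow> \<phi> i (u + v) = \<phi> i u + \<phi> i v"
    and scale: "\<And>i c v. i \<in> I \<Longrightarrow> \<phi> i (c *s v) = c * \<phi> i v"
    and frame: "\<And>v. v = (\<Sum>i\<in>I. \<phi> i v *s u i)"
  shows "trace A = (\<Sum>i\<in>I. \<phi> i (A *v u i))"
proof -
  have "trace A = (\<Sum>j\<in>UNIV. (A *v axis j 1) $ j)"
    by (simp add: trace_def matrix_vector_mult_axis)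
  also have "\<dots> = (\<Sum>j\<in>UNIV. \<Sum>i\<in>I. \<phi> i (A *v axis j 1) * u i $ j)"
  proof (rule sum.cong[OF refl])
    fix j
    have "(A *v axis j 1) $ j = (\<Sum>i\<in>I. \<phi> i (A *v axis j 1) *s u i) $ j"
      by (rule arg_cong[OF frame])
    then show "(A *v axis j 1) $ j = (\<Sum>i\<in>I. \<phi> i (A *v axis j 1) * u i $ j)" by simp
  qed
  also have "\<dots> = (\<Sum>i\<in>I. \<Sum>j\<in>UNIV. u i $ j * \<phi> i (A *v axis j 1))"
    by (subst sum.swap) (simp add: mult.commute)
  also have "\<dots> = (\<Sum>i\<in>I. \<phi> i (A *v u i))"
  proof (rule sum.cong[OF refl])
    fix i assume i: "i \<in> I"
    show "(\<Sum>j\<in>UNIV. u i $ j * \<phi> i (A *v axis j 1)) = \<phi> i (A *v u i)"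
      by (rule linear_functional_expansion[where \<phi> = "\<lambda>v. \<phi> i (A *v v)", symmetric])
        (simp_all add: matrix_vector_right_distrib vector_scalar_commute add[OF i] scale[OF i])
  qed
  finally show ?thesis .
qed

lemma unitary_rep_one:
  assumes "unitary_rep G \<rho>" "mat 1 \<in> G"
  shows "\<rho> (mat 1) = mat 1"
proof -
  have "unitary_matrix (\<rho> (mat 1))" using assms by (simp add: unitary_rep_def)
  then obtain B where B: "\<rho> (mat 1) ** B = mat 1" unfolding unitary_matrix_def by blast
  have "\<rho> (mat 1) ** \<rho> (mat 1) = \<rho> (mat 1)" using assms unfolding unitary_rep_def by (metis matrix_mul_lid)
  then have "\<rho> (mat 1) ** (\<rho> (mat 1) ** B) = \<rho> (mat 1) ** B" by (simp add: matrix_mul_assoc)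
  then show ?thesis by (simp add: B)
qed

lemma trace_rep_conj_by:
  assumes \<rho>: "unitary_rep G \<rho>" and G: "subgroup G SL2C" and k: "k \<in> G" and g: "g \<in> G"
  shows "trace (\<rho> (conj_by k g)) = trace (\<rho> g)"
proof -
  have hom: "\<rho> (x ** y) = \<rho> x ** \<rho> y" if "x \<in> G" "y \<in> G" for x y
    using \<rho> that by (simp add: unitary_rep_def)
  have ki: "matrix_inv k \<in> G" by (rule SL2C_sub_inv[OF G k])
  have "\<rho> (conj_by k g) = \<rho> k ** (\<rho> g ** \<rho> (matrix_inv k))"
    using k ki g by (simp add: conj_by_def hom SL2C_sub_mult[OF G] matrix_mul_assoc)
  then have "trace (\<rho> (conj_by k g)) = trace (\<rho> g ** (\<rho> (matrix_inv k) ** \<rho> k))"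
    using trace_mul_sym[of "\<rho> k" "\<rho> g ** \<rho> (matrix_inv k)"] by (simp add: matrix_mul_assoc)
  also have "\<rho> (matrix_inv k) ** \<rho> k = mat 1"
    using unitary_rep_one[OF \<rho> SL2C_sub_one[OF G]] SL2C_inverse(2)[OF SL2C_sub_det[OF G k]] hom[OF ki k] by simp
  finally show ?thesis by simp
qed

context group_pair
begin

text \<open>
  Frobenius formula. The functions supported on a single coset \<open>K r\<close> with a standard basis
  vector as value at \<open>r\<close> span the induced space, and the coordinates of a function are the
  components of its values at the representatives. Translation by \<open>g\<close> contributes to the
  diagonal at \<open>r\<close> only if it maps the coset \<open>K r\<close> to itself, that is, if
  \<open>r g r\<^sup>-\<^sup>1\<close> lies in \<open>K\<close>.
\<close>

lemma trace_induced:
  fixes chi :: "complex^2^2 \<Rightarrow> complex^'n^'n" and \<sigma> :: "complex^2^2 \<Rightarrow> complex^'m^'m"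
  assumes chi: "unitary_rep K chi" and ind: "is_induced_rep K G chi \<sigma>" and g: "g \<in> G"
  shows "trace (\<sigma> g) = (\<Sum>r\<in>{r\<in>R. conj_by r g \<in> K}. trace (chi (conj_by r g)))"
proof -
  obtain T :: "complex^'m \<Rightarrow> complex^2^2 \<Rightarrow> complex^'n" where
    bij: "bij_betw T UNIV (induced_space K G chi)"
    and add: "\<And>u v. T (u + v) = (\<lambda>x. T u x + T v x)"
    and scale: "\<And>c v. T (c *s v) = (\<lambda>x. c *s T v x)"
    and act: "\<And>h v. h \<in> G \<Longrightarrow> T (\<sigma> h *v v) = (\<lambda>x. T v (x ** h))"
    using ind unfolding is_induced_rep_def by blast
  have hom: "chi (x ** y) = chi x ** chi y" if "x \<in> K" "y \<in> K" for x y
    using chi that by (simp add: unitary_rep_def)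
  define e where "e = (\<lambda>(r, i) x. if x \<in> G \<and> x ** matrix_inv r \<in> K
    then chi (x ** matrix_inv r) *v axis i 1 else 0 :: complex^'n)"
  have e_space: "e (r, i) \<in> induced_space K G chi" if r: "r \<in> R" for r i
  proof -
    have "e (r, i) (k ** x) = chi k *v e (r, i) x" if k: "k \<in> K" and x: "x \<in> G" for k x
    proof -
      have kG: "k \<in> G" using k KG by blast
      have "k ** y \<in> K \<longleftrightarrow> y \<in> K" for y
        using multK[OF k] multK[OF invK[OF k], of "k ** y"] SL2C_inverse(2)[OF detK[OF k]]
        by (auto simp: matrix_mul_assoc)
      then have "(k ** x) ** matrix_inv r \<in> K \<longleftrightarrow> x ** matrix_inv r \<in> K"
        by (simp flip: matrix_mul_assoc)
      moreover have "chi ((k ** x) ** matrix_inv r) = chi k ** chi (x ** matrix_inv r)"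
        if "x ** matrix_inv r \<in> K"
        using hom[OF k that] by (simp add: matrix_mul_assoc)
      ultimately show ?thesis
        using x multG[OF kG x] by (simp add: e_def flip: matrix_vector_mul_assoc)
    qed
    then show ?thesis by (auto simp: induced_space_def e_def)
  qed
  have T_space: "T v \<in> induced_space K G chi" for v using bij by (auto simp: bij_betw_def)
  define u where "u = (\<lambda>p. inv_into UNIV T (e p))"
  have Tu: "T (u (r, i)) = e (r, i)" if "r \<in> R" for r i
    using e_space[OF that, of i] bij unfolding u_def by (auto simp: bij_betw_def intro!: f_inv_into_f)
  have T_zero: "T 0 = (\<lambda>x. 0)" using scale[of 0 0] by simp
  have T_sum: "T (\<Sum>i\<in>I. f i) = (\<lambda>x. \<Sum>i\<in>I. T (f i) x)" if "finite I"
    for I :: "((complex^2^2) \<times> 'n) set" and f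
    using that by induction (auto simp: T_zero add)
  let ?I = "R \<times> (UNIV :: 'n set)"
  let ?\<phi> = "\<lambda>(r, i) v. T v r $ i"
  have frame: "v = (\<Sum>p\<in>?I. ?\<phi> p v *s u p)" for v
  proof -
    have "T v x = (\<Sum>p\<in>?I. ?\<phi> p v *s e p x)" for x
    proof (cases "x \<in> G")
      case False
      then show ?thesis using T_space[of v] by (auto simp: induced_space_def e_def intro!: sum.neutral)
    next
      case True
      obtain r where r: "r \<in> R" "x ** matrix_inv r \<in> K" using rep_exists[OF True] by blast
      let ?k = "x ** matrix_inv r"
      have "(\<Sum>p\<in>?I. ?\<phi> p v *s e p x) = (\<Sum>s\<in>R. \<Sum>i\<in>UNIV. T v s $ i *s e (s, i) x)"
        by (simp add: sum.cartesian_product split_def)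
      also have "\<dots> = (\<Sum>s\<in>R. if s = r then \<Sum>i\<in>UNIV. T v r $ i *s (chi ?k *v axis i 1) else 0)"
      proof (intro sum.cong refl)
        fix s assume s: "s \<in> R"
        have "x ** matrix_inv s \<in> K \<longleftrightarrow> s = r" using rep_unique[OF True s r(1)] r(2) by blast
        then show "(\<Sum>i\<in>UNIV. T v s $ i *s e (s, i) x) =
            (if s = r then \<Sum>i\<in>UNIV. T v r $ i *s (chi ?k *v axis i 1) else 0)"
          using True by (simp add: e_def)
      qed
      also have "\<dots> = (\<Sum>i\<in>UNIV. T v r $ i *s (chi ?k *v axis i 1))"
        using finR r(1) by simp
      also have "\<dots> = chi ?k *v T v r"
        by (simp add: vec_eq_iff matrix_vector_mult_axis)
          (simp add: matrix_vector_mult_def mult.commute)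
      also have "\<dots> = T v (?k ** r)"
        using T_space[of v] r RG by (simp add: induced_space_def)
      also have "?k ** r = x" using detG[OF RG[OF r(1)]] by (simp add: SL2C_cancel)
      finally show ?thesis by simp
    qed
    moreover have "T (\<Sum>p\<in>?I. ?\<phi> p v *s u p) = (\<lambda>x. \<Sum>p\<in>?I. ?\<phi> p v *s e p x)"
      using finR Tu by (subst T_sum) (auto simp: scale fun_eq_iff intro!: sum.cong)
    ultimately have "T v = T (\<Sum>p\<in>?I. ?\<phi> p v *s u p)" by (simp add: fun_eq_iff)
    then show ?thesis using bij by (auto simp: bij_betw_def dest: injD)
  qed
  have "trace (\<sigma> g) = (\<Sum>p\<in>?I. ?\<phi> p (\<sigma> g *v u p))"
    by (rule trace_dual_frame[OF _ _ frame]) (auto simp: add scale)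
  also have "\<dots> = (\<Sum>r\<in>R. \<Sum>i\<in>UNIV. T (\<sigma> g *v u (r, i)) r $ i)"
    by (simp add: sum.cartesian_product split_def)
  also have "\<dots> = (\<Sum>r\<in>R. if conj_by r g \<in> K then trace (chi (conj_by r g)) else 0)"
  proof (intro sum.cong refl)
    fix r assume r: "r \<in> R"
    have "T (\<sigma> g *v u (r, i)) r $ i = (if conj_by r g \<in> K then chi (conj_by r g) $ i $ i else 0)" for i
      using multG[OF RG[OF r] g]
      by (simp add: act[OF g] Tu[OF r] e_def conj_by_def matrix_vector_mult_axis)
    then show "(\<Sum>i\<in>UNIV. T (\<sigma> g *v u (r, i)) r $ i) =
        (if conj_by r g \<in> K then trace (chi (conj_by r g)) else 0)"
      by (simp add: trace_def)
  qed
  also have "\<dots> = (\<Sum>r\<in>{r\<in>R. conj_by r g \<in> K}. trace (chi (conj_by r g)))"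
    by (rule sum.inter_filter[OF finR, symmetric])
  finally show ?thesis .
qed

end

section \<open>Comparison of the logarithmic derivatives\<close>

lemma conj_by_closed: "subgroup G SL2C \<Longrightarrow> g \<in> G \<Longrightarrow> P \<in> G \<Longrightarrow> conj_by g P \<in> G"
  by (simp add: conj_by_def SL2C_sub_mult SL2C_sub_inv)

lemma conj_class_self: "subgroup G SL2C \<Longrightarrow> P \<in> conj_class G P"
  unfolding conj_class_eq by (rule image_eqI[of _ _ "mat 1"]) (auto simp: SL2C_sub_one)

lemma conj_class_cong:
  assumes G: "subgroup G SL2C" and Q: "Q \<in> conj_class G P"
  shows "conj_class G Q = conj_class G P"
proof -
  obtain x where x: "x \<in> G" "Q = conj_by x P" using Q by (auto simp: conj_class_eq)
  have dx: "det x = 1" by (rule SL2C_sub_det[OF G x(1)])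
  have "conj_by g Q \<in> conj_class G P" if "g \<in> G" for g
    using that x SL2C_sub_mult[OF G that x(1)] SL2C_sub_det[OF G]
    by (auto simp: conj_class_eq conj_by_mult intro!: image_eqI[of _ _ "g ** x"])
  moreover have "conj_by g P \<in> conj_class G Q" if "g \<in> G" for g
    using that x SL2C_sub_mult[OF G that SL2C_sub_inv[OF G x(1)]] SL2C_sub_det[OF G] dx
    by (auto simp: conj_class_eq conj_by_mult SL2C_inverse intro!: image_eqI[of _ _ "g ** matrix_inv x"])
  ultimately show ?thesis unfolding conj_class_eq by blast
qed

lemma hyperbolic_class_choice:
  assumes G: "subgroup G SL2C" and D: "D \<in> hyperbolic_classes G" and Q: "Q = (SOME Q. Q \<in> D)"
  shows "Q \<in> G" "hyperbolic Q" "D = conj_class G Q" "Q \<in> D"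
proof -
  obtain P where P: "P \<in> G" "hyperbolic P" "D = conj_class G P"
    using D by (auto simp: hyperbolic_classes_def)
  then have "P \<in> D" using conj_class_self[OF G] by blast
  then show QD: "Q \<in> D" unfolding Q by (rule someI)
  then obtain x where x: "x \<in> G" "Q = conj_by x P" using P by (auto simp: conj_class_eq)
  then show "Q \<in> G" using P conj_by_closed[OF G] by simp
  show "hyperbolic Q" using x P hyperbolic_conj[OF SL2C_sub_det[OF G x(1)]] by (simp add: conj_by_def)
  show "D = conj_class G Q" using conj_class_cong[OF G] QD P by blast
qed

lemma card_centralizer_tor_pos:
  assumes "discrete_subgroup_pm G" "P \<in> G" "hyperbolic P"
  shows "card (centralizer_tor G P) > 0"
proof -
  have "det P = 1" using assms SL2C_sub_det by (auto simp: discrete_subgroup_pm_def)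
  then obtain v where "v \<noteq> 0" "P *v v = hyperbolic_eigenvalue P *s v"
    "cmod (hyperbolic_eigenvalue P) > 1"
    using hyperbolic_eigenvalue[OF _ assms(3)] by blast
  then interpret hyperbolic_axis G P "hyperbolic_eigenvalue P" v
    using assms by unfold_locales
  show ?thesis by (rule card_tor_pos)
qed

context group_pair
begin

text \<open>
  Writing an element of the smaller class as \<open>x P x\<^sup>-\<^sup>1\<close> with \<open>x = k r\<close>, the factor \<open>k\<close> does not
  change the class. As the set on the right is finite, so is the decomposition of a class of \<open>G\<close>
  into classes of \<open>K\<close>.
\<close>

lemma subclasses_subset_image:
  assumes P: "P \<in> G"
  shows "{D \<in> hyperbolic_classes K. D \<subseteq> conj_class G P} \<subseteq>
    (\<lambda>r. conj_class K (conj_by r P)) ` {r\<in>R. conj_by r P \<in> K}"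
proof safe
  fix D assume D: "D \<in> hyperbolic_classes K" "D \<subseteq> conj_class G P"
  define Q where "Q = (SOME Q. Q \<in> D)"
  note Q = hyperbolic_class_choice[OF sK D(1) Q_def]
  obtain x where x: "x \<in> G" "Q = conj_by x P" using D(2) Q(4) by (auto simp: conj_class_eq)
  obtain r where r: "r \<in> R" "x ** matrix_inv r \<in> K" using rep_exists[OF x(1)] by blast
  define k where "k = x ** matrix_inv r"
  have k: "k \<in> K" "det k = 1" "det r = 1" using r RG detG detK by (auto simp: k_def)
  have "k ** r = x" using k by (simp add: k_def SL2C_cancel)
  then have "Q = conj_by k (conj_by r P)" using x k conj_by_mult by metis
  then have eq: "conj_by r P = conj_by (matrix_inv k) Q" using k by auto
  then have "conj_by r P \<in> conj_class K Q" using invK[OF k(1)] by (auto simp: conj_class_eq)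
  then have "D = conj_class K (conj_by r P)" using conj_class_cong[OF sK] Q(3) by blast
  moreover have "conj_by r P \<in> K"
    unfolding eq by (rule conj_by_closed[OF sK invK[OF k(1)] Q(1)])
  ultimately show "D \<in> (\<lambda>r. conj_class K (conj_by r P)) ` {r\<in>R. conj_by r P \<in> K}"
    using r by blast
qed

text \<open>
  The Frobenius formula, with the representatives grouped by the class in \<open>K\<close> of the conjugate
  that they produce. Within a group all traces are equal, and the size of the group is what
  \<open>count_conjugates\<close> computes. Norm and eigenvalue depend on the trace only, so the remaining
  factors of the summands agree.
\<close>

lemma selberg_term_induced:
  fixes chi :: "complex^2^2 \<Rightarrow> complex^'n^'n" and \<sigma> :: "complex^2^2 \<Rightarrow> complex^'m^'m"
  assumes chi: "unitary_rep K chi" and ind: "is_induced_rep K G chi \<sigma>"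
    and P: "P \<in> G" "hyperbolic P"
  shows "selberg_term G \<sigma> s P =
    (\<Sum>D | D \<in> hyperbolic_classes K \<and> D \<subseteq> conj_class G P. selberg_term K chi s (SOME Q. Q \<in> D))"
proof -
  let ?T = "{D \<in> hyperbolic_classes K. D \<subseteq> conj_class G P}"
  let ?S = "{r\<in>R. conj_by r P \<in> K}"
  let ?cls = "\<lambda>r. conj_class K (conj_by r P)"
  let ?tr = "\<lambda>r. trace (chi (conj_by r P))"
  \<comment> \<open>the part of the summand that does not involve the representation\<close>
  define c where "c = of_real (ln (hyperbolic_norm (primitive_element G P))) /
       of_real (real (card (centralizer_tor G P)) *
         (cmod (hyperbolic_eigenvalue P - inverse (hyperbolic_eigenvalue P)))\<^sup>2) *
     complex_of_real (hyperbolic_norm P) powr (- s)"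
  have finS: "finite ?S" using finR by simp
  have finT: "finite ?T" using subclasses_subset_image[OF P(1)] finS by (meson finite_imageI finite_subset)
  have sub: "?cls ` ?S \<subseteq> ?T"
  proof safe
    fix r assume r: "r \<in> R" "conj_by r P \<in> K"
    have "hyperbolic (conj_by r P)"
      using P hyperbolic_conj[OF detG[OF RG[OF r(1)]]] by (simp add: conj_by_def)
    then show "?cls r \<in> hyperbolic_classes K" using r by (auto simp: hyperbolic_classes_def)
    fix Q assume "Q \<in> ?cls r"
    then obtain k where "k \<in> K" "Q = conj_by k (conj_by r P)" by (auto simp: conj_class_eq)
    then have "Q = conj_by (k ** r) P" "k ** r \<in> G"
      using detK detG RG r KG multG by (auto simp: conj_by_mult)
    then show "Q \<in> conj_class G P" by (auto simp: conj_class_eq)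
  qed
  have "(\<Sum>r\<in>{r\<in>?S. ?cls r = D}. ?tr r) * c = selberg_term K chi s (SOME Q. Q \<in> D)"
    if D: "D \<in> ?T" for D
  proof -
    define Q where "Q = (SOME Q. Q \<in> D)"
    from D have "D \<in> hyperbolic_classes K" by simp
    note Q = hyperbolic_class_choice[OF sK this Q_def]
    obtain x where x: "x \<in> G" "Q = conj_by x P" using D Q(4) by (auto simp: conj_class_eq)
    let ?S' = "{r\<in>R. conj_by r P \<in> conj_class K Q}"
    have in_K: "A \<in> K" if "A \<in> conj_class K Q" for A
      using that conj_by_closed[OF sK _ Q(1)] by (auto simp: conj_class_eq)
    have eq: "{r\<in>?S. ?cls r = D} = ?S'"
      unfolding Q(3) using in_K conj_class_self[OF sK] conj_class_cong[OF sK] by blast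
    have "?tr r = trace (chi Q)" if "r \<in> ?S'" for r
      using that trace_rep_conj_by[OF chi sK _ Q(1)] by (auto simp: conj_class_eq)
    then have tr: "(\<Sum>r\<in>?S'. ?tr r) = of_nat (card ?S') * trace (chi Q)" by simp
    have ev: "hyperbolic_eigenvalue Q = hyperbolic_eigenvalue P"
      unfolding x(2) conj_by_def using x(1) P(1) detG by (intro hyperbolic_eigenvalue_conj)
    have norm: "hyperbolic_norm Q = hyperbolic_norm P" by (simp add: hyperbolic_norm_def ev)
    have pos: "card (centralizer_tor G P) > 0" "card (centralizer_tor K Q) > 0"
      using card_centralizer_tor_pos G K P Q by auto
    have "card ?S' * card (centralizer_tor K Q) * ln (hyperbolic_norm (primitive_element G P)) =
        card (centralizer_tor G P) * ln (hyperbolic_norm (primitive_element K Q))"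
      by (rule count_conjugates[OF P Q(1) x(2,1)])
    then have "card ?S' * (ln (hyperbolic_norm (primitive_element G P)) / card (centralizer_tor G P)) =
        ln (hyperbolic_norm (primitive_element K Q)) / card (centralizer_tor K Q)"
      using pos by (simp add: field_simps)
    from arg_cong[OF this, of complex_of_real]
    have "of_nat (card ?S') * (of_real (ln (hyperbolic_norm (primitive_element G P))) /
          of_nat (card (centralizer_tor G P))) =
        complex_of_real (ln (hyperbolic_norm (primitive_element K Q))) / of_nat (card (centralizer_tor K Q))"
      by simp
    then have key: "of_nat (card ?S') * (of_real (ln (hyperbolic_norm (primitive_element G P))) /
          of_nat (card (centralizer_tor G P))) * y =
        complex_of_real (ln (hyperbolic_norm (primitive_element K Q))) / of_nat (card (centralizer_tor K Q)) * y"
      for y by simp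
    show ?thesis
      unfolding eq tr c_def selberg_term_def Q_def[symmetric] ev norm
      using key[of "trace (chi Q) / of_real ((cmod (hyperbolic_eigenvalue P -
        inverse (hyperbolic_eigenvalue P)))\<^sup>2) * complex_of_real (hyperbolic_norm P) powr (- s)"]
      by (simp add: mult.assoc mult.left_commute mult.commute)
  qed
  then have "(\<Sum>D\<in>?T. selberg_term K chi s (SOME Q. Q \<in> D)) =
      (\<Sum>D\<in>?T. \<Sum>r\<in>{r\<in>?S. ?cls r = D}. ?tr r) * c"
    by (simp add: sum_distrib_right)
  also have "(\<Sum>D\<in>?T. \<Sum>r\<in>{r\<in>?S. ?cls r = D}. ?tr r) = (\<Sum>r\<in>?S. ?tr r)"
    by (rule sum.group[OF finS finT sub])
  also have "\<dots> = trace (\<sigma> P)" by (rule trace_induced[OF chi ind P(1), symmetric])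
  also have "\<dots> * c = selberg_term G \<sigma> s P" by (simp add: c_def selberg_term_def)
  finally show ?thesis by simp
qed

lemma is_selberg_zeta_induced:
  fixes chi :: "complex^2^2 \<Rightarrow> complex^'n^'n" and \<sigma> :: "complex^2^2 \<Rightarrow> complex^'m^'m"
  assumes chi: "unitary_rep K chi" and ind: "is_induced_rep K G chi \<sigma>"
    and Z: "is_selberg_zeta K chi Z"
  shows "is_selberg_zeta G \<sigma> Z"
proof -
  let ?B = "\<lambda>C. {D \<in> hyperbolic_classes K. D \<subseteq> C}"
  have "inj_on snd (Sigma (hyperbolic_classes G) ?B)"
  proof (rule inj_onI, clarsimp)
    fix C C' D assume C: "C \<in> hyperbolic_classes G" "C' \<in> hyperbolic_classes G"
      and D: "D \<in> hyperbolic_classes K" "D \<subseteq> C" "D \<subseteq> C'"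
    have "(SOME Q. Q \<in> D) \<in> D" by (rule hyperbolic_class_choice(4)[OF sK D(1) refl])
    then have "(SOME Q. Q \<in> D) \<in> C" "(SOME Q. Q \<in> D) \<in> C'" using D by auto
    moreover have "C = conj_class G Q" if "C \<in> hyperbolic_classes G" "Q \<in> C" for C Q
      using that conj_class_cong[OF sG] by (force simp: hyperbolic_classes_def)
    ultimately show "C = C'" using C by metis
  qed
  moreover have "snd ` Sigma (hyperbolic_classes G) ?B = hyperbolic_classes K"
  proof (intro equalityI subsetI)
    fix D assume D: "D \<in> hyperbolic_classes K"
    then obtain Q where Q: "Q \<in> K" "hyperbolic Q" "D = conj_class K Q"
      by (auto simp: hyperbolic_classes_def)
    then have "conj_class G Q \<in> hyperbolic_classes G" "D \<subseteq> conj_class G Q"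
      using KG by (auto simp: hyperbolic_classes_def conj_class_eq)
    then show "D \<in> snd ` Sigma (hyperbolic_classes G) ?B" using D by force
  qed auto
  ultimately have bij: "bij_betw snd (Sigma (hyperbolic_classes G) ?B) (hyperbolic_classes K)"
    by (simp add: bij_betw_def)
  have "((\<lambda>C. selberg_term G \<sigma> s (SOME P. P \<in> C)) has_sum (deriv Z s / Z s)) (hyperbolic_classes G)"
    if s: "Re s > 1" for s
  proof (rule has_sum_Sigma')
    have "((\<lambda>D. selberg_term K chi s (SOME Q. Q \<in> D)) has_sum (deriv Z s / Z s)) (hyperbolic_classes K)"
      using Z s by (simp add: is_selberg_zeta_def)
    then show "((\<lambda>p. selberg_term K chi s (SOME Q. Q \<in> snd p)) has_sum (deriv Z s / Z s))
        (Sigma (hyperbolic_classes G) ?B)"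
      by (subst has_sum_reindex_bij_betw[OF bij])
    fix C assume C: "C \<in> hyperbolic_classes G"
    define P where "P = (SOME P. P \<in> C)"
    note P = hyperbolic_class_choice[OF sG C P_def]
    have "finite (?B C)"
      unfolding P(3) by (rule finite_subset[OF subclasses_subset_image[OF P(1)]]) (use finR in simp)
    then have "((\<lambda>D. selberg_term K chi s (SOME Q. Q \<in> D)) has_sum
        (\<Sum>D\<in>?B C. selberg_term K chi s (SOME Q. Q \<in> D))) (?B C)"
      by (rule has_sum_finite)
    also have "(\<Sum>D\<in>?B C. selberg_term K chi s (SOME Q. Q \<in> D)) = selberg_term G \<sigma> s P"
      using selberg_term_induced[OF chi ind P(1,2), of s] P(3) by simp
    finally show "((\<lambda>D. selberg_term K chi s (SOME Q. Q \<in> snd (C, D))) has_sum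
        selberg_term G \<sigma> s (SOME P. P \<in> C)) (?B C)"
      by (simp add: P_def)
  qed
  then show ?thesis using Z by (simp add: is_selberg_zeta_def)
qed

end

section \<open>Meromorphic continuation\<close>

text \<open>
  The difference need not be normalised at common poles, so the removable singularities of
  the difference are filled before the identity theorem is applied. Equality at the remaining
  points follows from the convention that a nicely meromorphic function is 0 at its poles.
\<close>

lemma nicely_meromorphic_identity:
  assumes U: "open U" "connected U" and F: "F nicely_meromorphic_on U" "F' nicely_meromorphic_on U"
    and V: "open V" "V \<subseteq> U" "V \<noteq> {}" and eq: "\<And>s. s \<in> V \<Longrightarrow> F s = F' s" and s: "s \<in> U"
  shows "F s = F' s"
proof -
  define H where "H = remove_sings (\<lambda>z. F z - F' z)"
  have mer: "F meromorphic_on U" "F' meromorphic_on U"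
    using F by (auto simp: nicely_meromorphic_on_def)
  then have mer': "(\<lambda>z. F z - F' z) meromorphic_on U" by (intro meromorphic_intros)
  then have H: "H nicely_meromorphic_on U"
    unfolding H_def by (rule remove_sings_nicely_meromorphic)
  have ev: "eventually (\<lambda>w. H w = F w - F' w) (at z)" if "z \<in> U" for z
    unfolding H_def using mer' that
    by (intro eventually_remove_sings_eq_at meromorphic_on_isolated_singularity) 
      (auto intro: meromorphic_on_subset)
  obtain z where z: "z \<in> V" using V by blast
  then have "eventually (\<lambda>w. w \<in> V) (at z)" using V(1) eventually_at_in_open' by blast
  moreover have "eventually (\<lambda>w. H w = F w - F' w) (at z)" using ev z V by blast
  ultimately have "eventually (\<lambda>w. H w = 0) (at z)"
    by eventually_elim (simp add: eq)
  then have "frequently (\<lambda>w. H w = 0) (at z)" by (intro eventually_frequently) auto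
  then have H0: "H w = 0" if "w \<in> U" for w
    using frequently_eq_meromorphic_imp_constant[OF _ H U] z V(2) that by blast
  have "eventually (\<lambda>w. w \<in> U) (at s)" using U(1) s eventually_at_in_open' by blast
  with ev[OF s] have near: "eventually (\<lambda>w. F w = F' w) (at s)"
    by eventually_elim (simp add: H0)
  have pole: "is_pole F s \<longleftrightarrow> is_pole F' s"
    by (rule is_pole_cong[OF near refl])
  show ?thesis
  proof (cases "is_pole F s")
    case True
    then have "\<not> F \<midarrow>s\<rightarrow> F s" "\<not> F' \<midarrow>s\<rightarrow> F' s"
      using pole not_tendsto_and_filterlim_at_infinity[of "at s"] by (auto simp: is_pole_def)
    then have "F s = 0" "F' s = 0" using F s unfolding nicely_meromorphic_on_def by blast+
    then show ?thesis by simp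
  next
    case False
    then have lim: "F \<midarrow>s\<rightarrow> F s" "F' \<midarrow>s\<rightarrow> F' s"
      using F s pole by (auto simp: nicely_meromorphic_on_def)
    then have "F' \<midarrow>s\<rightarrow> F s" using tendsto_cong[OF near] by blast
    then show ?thesis using lim(2) tendsto_unique[OF trivial_limit_at] by blast
  qed
qed

theorem mainTheorem2:
  fixes \<Gamma> \<Gamma>' :: "(complex^2^2) set"
    and chi :: "complex^2^2 \<Rightarrow> complex^'n^'n"
    and \<pi> :: "complex^2^2 \<Rightarrow> complex^'m^'m"
    and Z Z' :: "complex \<Rightarrow> complex"
  assumes "discrete_subgroup_pm \<Gamma>" and "discrete_subgroup_pm \<Gamma>'"
    and "\<Gamma> \<subseteq> \<Gamma>'" and "finite_covolume \<Gamma>" and "finite_index \<Gamma> \<Gamma>'"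
    and "unitary_rep \<Gamma> chi" and "is_induced_rep \<Gamma> \<Gamma>' chi \<pi>"
    and "is_selberg_zeta \<Gamma> chi Z" and "is_selberg_zeta \<Gamma>' \<pi> Z'"
  shows "(\<forall>s. Re s > 1 \<longrightarrow> Z s = Z' s) \<and>
    (\<forall>U F F'. open U \<and> connected U \<and> {s. Re s > 1} \<subseteq> U \<and>
        F nicely_meromorphic_on U \<and> (\<forall>s. Re s > 1 \<longrightarrow> F s = Z s) \<and>
        F' nicely_meromorphic_on U \<and> (\<forall>s. Re s > 1 \<longrightarrow> F' s = Z' s)
        \<longrightarrow> (\<forall>s\<in>U. F s = F' s))"
proof -
  have sub: "subgroup \<Gamma> SL2C" "subgroup \<Gamma>' SL2C"
    using assms(1,2) by (auto simp: discrete_subgroup_pm_def)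
  obtain R where "finite R" "right_transversal \<Gamma> \<Gamma>' R"
    using right_transversal_exists[OF sub assms(3,5)] by blast
  then interpret group_pair \<Gamma> \<Gamma>' R
    using assms by unfold_locales
  have "is_selberg_zeta \<Gamma>' \<pi> Z"
    by (rule is_selberg_zeta_induced[OF assms(6,7,8)])
  then have eq: "Z s = Z' s" if "Re s > 1" for s
    using is_selberg_zeta_unique assms(9) that by blast
  have "F s = F' s"
    if "open U" "connected U" "{s. Re s > 1} \<subseteq> U" "F nicely_meromorphic_on U"
      "\<forall>s. Re s > 1 \<longrightarrow> F s = Z s" "F' nicely_meromorphic_on U" "\<forall>s. Re s > 1 \<longrightarrow> F' s = Z' s" "s \<in> U"
    for U F F' s
  proof (rule nicely_meromorphic_identity[where U = U and F = F and F' = F' and V = "{s. Re s > 1}"])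
    show "open {s. Re s > 1}" by (rule open_halfspace_Re_gt)
    show "{s. Re s > 1} \<noteq> {}" by (auto intro!: exI[of _ 2])
  qed (use that eq in auto)
  then show ?thesis using eq by blast
qed

end
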